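(* The centred sequence $\xi_N:=\widehat\theta^{(N)}-\theta$, $N\ge1$, is jointly Gaussian and satisfies $$\mathbb E[\xi_N\xi_{N'}]=v_{N\vee N'}\qquad\text{for all }N,N'\ge1,$$ where $N\vee N'=\max(N,N')$. Consequently $\{\widehat\theta^{(N)}\}_{N\ge1}$ has independent increments: for any $N_1\le N_2\le N_3\le N_4$, $$\mathrm{Cov}\bigl(\widehat\theta^{(N_4)}-\widehat\theta^{(N_3)},\ \widehat\theta^{(N_2)}-\widehat\theta^{(N_1)}\bigr)=0,$$ and the two increments are independent.
   Context: Fix a mesh $h>0$, an integer $m\ge1$ and known Hurst parameters $H_1,\dots,H_m\in(1/2,1)$. Let $B^{H_1},\dots,B^{H_m}$ be independent fractional Brownian motions on one probability space, i.e. independent centred continuous Gaussian processes with $B^{H_r}(0)=0$ and $\mathbb E[B^{H_r}(t)B^{H_r}(s)]=\frac12(t^{2H_r}+s^{2H_r}-|t-s|^{2H_r})$ for $s,t\ge0$. For $\theta\in\mathbb R$ and $\alpha>0$ set $Z(t)=\theta t+\alpha\sum_{r=1}^m B^{H_r}(t)$ and $t_k=kh$. For $N\ge1$ let $\mathbf T_N=(t_1,\dots,t_N)^\top$, $\mathbf Z^{(N)}=(Z(t_1),\dots,Z(t_N))^\top$, and let $\Gamma_{H,N}$ be the $N\times N$ positive definite matrix with entries $\frac12\sum_{r=1}^m(t_i^{2H_r}+t_j^{2H_r}-|t_i-t_j|^{2H_r})$. Put $d_N=\mathbf T_N^\top\Gamma_{H,N}^{-1}\mathbf T_N$, $\widehat\theta^{(N)}=\mathbf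 T_N^\top\Gamma_{H,N}^{-1}\mathbf Z^{(N)}/d_N$ and $v_N=\mathrm{Var}(\widehat\theta^{(N)})=\alpha^2/d_N$. *)

theory Defs
  imports
    "HOL-Probability.Probability"
    "Jordan_Normal_Form.Gauss_Jordan_Elimination"
begin

text \<open>Normal laws include the degenerate ones (point masses), as is usual for Gaussian
  processes: e.g. a fractional Brownian motion vanishes at time 0.\<close>

definition gaussian_rv :: "'a measure \<Rightarrow> ('a \<Rightarrow> real) \<Rightarrow> bool" where
  "gaussian_rv M X \<longleftrightarrow>
     X \<in> borel_measurable M \<and>
     ((\<exists>\<mu>. AE \<omega> in M. X \<omega> = \<mu>) \<or>
      (\<exists>\<mu> \<sigma>. \<sigma> > 0 \<and> distributed M lborel X (normal_density \<mu> \<sigma>)))"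

definition jointly_gaussian :: "'a measure \<Rightarrow> 'i set \<Rightarrow> ('i \<Rightarrow> 'a \<Rightarrow> real) \<Rightarrow> bool" where
  "jointly_gaussian M I X \<longleftrightarrow>
     (\<forall>J c. finite J \<and> J \<subseteq> I \<longrightarrow> gaussian_rv M (\<lambda>\<omega>. \<Sum>i\<in>J. c i * X i \<omega>))"

definition covariance :: "'a measure \<Rightarrow> ('a \<Rightarrow> real) \<Rightarrow> ('a \<Rightarrow> real) \<Rightarrow> real" where
  "covariance M X Y =
     (LINT \<omega>|M. (X \<omega> - (LINT \<omega>'|M. X \<omega>')) * (Y \<omega> - (LINT \<omega>'|M. Y \<omega>')))"

definition independent_increments ::
    "'a measure \<Rightarrow> 'i::linorder set \<Rightarrow> ('i \<Rightarrow> 'a \<Rightarrow> real) \<Rightarrow> bool" where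
  "independent_increments M I X \<longleftrightarrow>
     (\<forall>k (t :: nat \<Rightarrow> 'i). t ` {..k} \<subseteq> I \<and> mono_on {..k} t \<longrightarrow>
        prob_space.indep_vars M (\<lambda>_. borel) (\<lambda>j \<omega>. X (t (Suc j)) \<omega> - X (t j) \<omega>) {..<k})"

definition fbm_cov :: "real \<Rightarrow> real \<Rightarrow> real \<Rightarrow> real" where
  "fbm_cov H s t = (s powr (2 * H) + t powr (2 * H) - \<bar>t - s\<bar> powr (2 * H)) / 2"

text \<open>Fractional Brownian motion on \<open>[0, \<infinity>)\<close>; values at negative times are irrelevant.
  Path continuity and the value at 0 are only required almost surely, which covers both
  conventions in use.\<close>

definition fractional_brownian_motion ::
    "'a measure \<Rightarrow> real \<Rightarrow> (real \<Rightarrow> 'a \<Rightarrow> real) \<Rightarrow> bool" where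
  "fractional_brownian_motion M H B \<longleftrightarrow>
     jointly_gaussian M {0..} B \<and>
     (\<forall>t\<ge>0. (LINT \<omega>|M. B t \<omega>) = 0) \<and>
     (AE \<omega> in M. continuous_on {0..} (\<lambda>t. B t \<omega>)) \<and>
     (AE \<omega> in M. B 0 \<omega> = 0) \<and>
     (\<forall>s\<ge>0. \<forall>t\<ge>0. (LINT \<omega>|M. B t \<omega> * B s \<omega>) = fbm_cov H s t)"

text \<open>Independence of whole processes: each process is a random variable with values in
  the product space of real functions on \<open>[0, \<infinity>)\<close>.\<close>

definition independent_processes ::
    "'a measure \<Rightarrow> 'r set \<Rightarrow> ('r \<Rightarrow> real \<Rightarrow> 'a \<Rightarrow> real) \<Rightarrow> bool" where
  "independent_processes M R B \<longleftrightarrow>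
     prob_space.indep_vars M (\<lambda>_. PiM {0..} (\<lambda>_. borel))
       (\<lambda>r \<omega>. restrict (\<lambda>t. B r t \<omega>) {0..}) R"

definition mixed_process ::
    "nat \<Rightarrow> real \<Rightarrow> real \<Rightarrow> (nat \<Rightarrow> real \<Rightarrow> 'a \<Rightarrow> real) \<Rightarrow> real \<Rightarrow> 'a \<Rightarrow> real" where
  "mixed_process m \<theta> \<alpha> B t \<omega> = \<theta> * t + \<alpha> * (\<Sum>r=1..m. B r t \<omega>)"

definition grid :: "real \<Rightarrow> nat \<Rightarrow> real" where
  "grid h k = real k * h"

text \<open>Vectors and matrices are indexed from 0, so entry \<open>i\<close> belongs to the time \<open>t\<^sub>i\<^sub>+\<^sub>1\<close>.\<close>

definition time_vec :: "real \<Rightarrow> nat \<Rightarrow> real Matrix.vec" where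
  "time_vec h N = Matrix.vec N (\<lambda>i. grid h (Suc i))"

definition obs_vec :: "real \<Rightarrow> nat \<Rightarrow> (real \<Rightarrow> 'a \<Rightarrow> real) \<Rightarrow> 'a \<Rightarrow> real Matrix.vec" where
  "obs_vec h N Z \<omega> = Matrix.vec N (\<lambda>i. Z (grid h (Suc i)) \<omega>)"

definition Gamma_mat :: "real \<Rightarrow> nat \<Rightarrow> (nat \<Rightarrow> real) \<Rightarrow> nat \<Rightarrow> real Matrix.mat" where
  "Gamma_mat h m H N =
     Matrix.mat N N (\<lambda>(i, j). \<Sum>r=1..m. fbm_cov (H r) (grid h (Suc i)) (grid h (Suc j)))"

text \<open>\<open>mat_inverse\<close> returns \<open>None\<close> on singular matrices; \<open>Gamma_mat\<close> is
  positive definite under the assumptions made on its parameters.\<close>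

definition Gamma_inv :: "real \<Rightarrow> nat \<Rightarrow> (nat \<Rightarrow> real) \<Rightarrow> nat \<Rightarrow> real Matrix.mat" where
  "Gamma_inv h m H N = the (mat_inverse (Gamma_mat h m H N))"

definition d_coeff :: "real \<Rightarrow> nat \<Rightarrow> (nat \<Rightarrow> real) \<Rightarrow> nat \<Rightarrow> real" where
  "d_coeff h m H N =
     scalar_prod (time_vec h N) (mult_mat_vec (Gamma_inv h m H N) (time_vec h N))"

definition theta_hat ::
    "real \<Rightarrow> nat \<Rightarrow> (nat \<Rightarrow> real) \<Rightarrow> (real \<Rightarrow> 'a \<Rightarrow> real) \<Rightarrow> nat \<Rightarrow> 'a \<Rightarrow> real" where
  "theta_hat h m H Z N \<omega> =
     scalar_prod (time_vec h N) (mult_mat_vec (Gamma_inv h m H N) (obs_vec h N Z \<omega>))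
       / d_coeff h m H N"

definition v_coeff :: "real \<Rightarrow> nat \<Rightarrow> (nat \<Rightarrow> real) \<Rightarrow> real \<Rightarrow> nat \<Rightarrow> real" where
  "v_coeff h m H \<alpha> N = \<alpha>\<^sup>2 / d_coeff h m H N"

end

theory Submission
  imports
    Defs
    "HOL-Real_Asymp.Real_Asymp"
    "Jordan_Normal_Form.Determinant"
begin

text \<open>Write \<open>w\<^sub>N = \<Gamma>\<^sub>N\<^sup>-\<^sup>1 T\<^sub>N\<close>, so that the error of the estimator is
  \<open>(\<alpha> / d\<^sub>N) \<Sum>\<^sub>i w\<^sub>N(i) G(t\<^sub>i)\<close> for the summed noise \<open>G\<close>. For \<open>N \<le> N'\<close> the matrix
  \<open>\<Gamma>\<^sub>N\<close> is a block of \<open>\<Gamma>\<^sub>N\<^sub>'\<close>, hence the first \<open>N\<close> entries of \<open>\<Gamma>\<^sub>N\<^sub>' w\<^sub>N\<^sub>'\<close> are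
  \<open>T\<^sub>N\<close> and the covariance of the two errors collapses to
  \<open>\<alpha>\<^sup>2 (w\<^sub>N \<bullet> T\<^sub>N) / (d\<^sub>N d\<^sub>N\<^sub>') = \<alpha>\<^sup>2 / d\<^sub>N\<^sub>'\<close>.
  A covariance depending only on the maximum of the indices makes increments over
  non-overlapping index ranges uncorrelated, and uncorrelated jointly Gaussian variables are
  independent.

  The matrix \<open>\<Gamma>\<^sub>N\<close> is invertible because a vanishing combination \<open>\<Sum>\<^sub>i c\<^sub>i B(t\<^sub>i)\<close> of one
  fractional Brownian motion would be uncorrelated with \<open>B(s)\<close> for every \<open>s \<ge> 0\<close>, whereas
  its covariance with \<open>B(s)\<close>, as a function of \<open>s\<close>, is not \<open>C\<^sup>2\<close> at \<open>t\<^sub>k\<close> unless \<open>c\<^sub>k = 0\<close>.\<close>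

section \<open>Characteristic functions of Gaussian laws\<close>

text \<open>Reweighting the measure by the positive density \<open>(W + K + 1) / (c + K + 1)\<close> does not
  change the characteristic function of \<open>Y\<close>, hence not its law.\<close>

lemma (in prob_space) weighted_Levy_uniqueness_real:
  fixes W Y :: "'a \<Rightarrow> real" and c K :: real
  assumes [measurable]: "W \<in> borel_measurable M" "Y \<in> borel_measurable M" "A \<in> sets borel"
    and bounded: "\<And>\<omega>. \<bar>W \<omega>\<bar> \<le> K"
    and char_eq: "\<And>t. (CLINT \<omega>|M. W \<omega> * iexp (t * Y \<omega>)) = c * (CLINT \<omega>|M. iexp (t * Y \<omega>))"
  shows "(LINT \<omega>|M. W \<omega> * indicator A (Y \<omega>)) = c * prob (Y -` A \<inter> space M)"
proof -
  have int_W: "integrable M W"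
    using bounded by (intro integrable_const_bound[of _ K]) auto
  \<comment> \<open>At \<open>t = 0\<close> the hypothesis identifies \<open>c\<close> as the mean
    of \<open>W\<close>. Hence \<open>c\<close> inherits the bound \<open>K\<close>, and the shift
    by \<open>K + 1\<close> makes both \<open>W + K + 1\<close> and its mean positive.\<close>
  have "complex_of_real (expectation W) = complex_of_real c"
    using char_eq[of 0] by (simp add: prob_space)
  then have EW: "expectation W = c"
    using of_real_eq_iff by blast
  have "\<bar>c\<bar> \<le> K"
    unfolding EW[symmetric]
    using order_trans[OF integral_abs_bound[of M W], of K] integral_mono[OF integrable_abs[OF int_W], of "\<lambda>_. K"] bounded
    by (simp add: prob_space)
  then have pos: "0 < c + (K + 1)" by linarith
  define V where "V \<omega> = (W \<omega> + (K + 1)) / (c + (K + 1))" for \<omega>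
  have [measurable]: "V \<in> borel_measurable M" unfolding V_def by measurable
  have V_nonneg: "0 \<le> V \<omega>" for \<omega>
    using bounded[of \<omega>] pos unfolding V_def by (intro divide_nonneg_pos) linarith+
  have int_V: "integrable M V" unfolding V_def using int_W by simp
  have EV: "expectation V = 1"
    unfolding V_def using int_W pos by (simp add: prob_space EW)
  \<comment> \<open>\<open>V\<close> is nonnegative with mean 1, so reweighting by it gives a
    probability measure, to which Levy uniqueness applies.\<close>
  have "emeasure (density M V) (space M) = 1"
    by (simp add: emeasure_density cong: nn_integral_cong)
       (use nn_integral_eq_integral[OF int_V] V_nonneg EV in simp)
  then interpret N: prob_space "density M V"
    by (intro prob_spaceI) simp
  have D1: "real_distribution (distr (density M V) borel Y)" 
    by (rule N.real_distribution_distr) simp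
  have D2: "real_distribution (distr M borel Y)" 
    by (rule real_distribution_distr) simp
  have "char (distr (density M V) borel Y) t = char (distr M borel Y) t" for t
  proof -
    have int_e: "integrable M (\<lambda>\<omega>. iexp (t * Y \<omega>))"
      by (intro integrable_const_bound[of _ 1]) auto
    have int_We: "integrable M (\<lambda>\<omega>. W \<omega> * iexp (t * Y \<omega>))"
      using bounded by (intro integrable_const_bound[of _ K]) (auto simp: norm_mult)
    have "char (distr (density M V) borel Y) t = (CLINT \<omega>|M. V \<omega> *\<^sub>R iexp (t * Y \<omega>))"
      using V_nonneg by (simp add: char_def integral_distr integral_density)
    also have "\<dots> = (CLINT \<omega>|M. (W \<omega> * iexp (t * Y \<omega>) + (K + 1) * iexp (t * Y \<omega>)) / (c + (K + 1)))"
      unfolding V_def by (intro Bochner_Integration.integral_cong) (auto simp: scaleR_conv_of_real algebra_simps add_divide_distrib)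
    also have "\<dots> = (c * (CLINT \<omega>|M. iexp (t * Y \<omega>)) + (K + 1) * (CLINT \<omega>|M. iexp (t * Y \<omega>))) / (c + (K + 1))"
      using int_e int_We char_eq[of t] by simp
    also have "\<dots> = (c + (K + 1)) * (CLINT \<omega>|M. iexp (t * Y \<omega>)) / complex_of_real (c + (K + 1))"
      by (simp add: algebra_simps)
    also have "\<dots> = (CLINT \<omega>|M. iexp (t * Y \<omega>))"
      using pos by (metis less_irrefl nonzero_mult_div_cancel_left of_real_eq_0_iff)
    finally show ?thesis by (simp add: char_def integral_distr)
  qed
  then have "distr (density M V) borel Y = distr M borel Y"
    by (intro Levy_uniqueness[OF D1 D2] ext)
  then have "measure (distr (density M V) borel Y) A = measure (distr M borel Y) A" by simp
  then have "N.expectation (\<lambda>\<omega>. indicator A (Y \<omega>)) = prob (Y -` A \<inter> space M)"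
    by (simp add: measure_distr indicator_vimage[symmetric])
  then have "(LINT \<omega>|M. V \<omega> * indicator A (Y \<omega>)) = prob (Y -` A \<inter> space M)"
    using V_nonneg by (simp add: integral_density)
  \<comment> \<open>\<open>V\<close> is affine in \<open>W\<close>. Its constant part contributes a
    multiple of the probability, which is finally subtracted from both sides.\<close>
  moreover have "(LINT \<omega>|M. V \<omega> * indicator A (Y \<omega>)) =
     (LINT \<omega>|M. (W \<omega> * indicator A (Y \<omega>) + (K + 1) * indicator A (Y \<omega>)) / (c + (K + 1)))"
    unfolding V_def by (intro Bochner_Integration.integral_cong) (auto simp: algebra_simps)
  moreover have "\<dots> = ((LINT \<omega>|M. W \<omega> * indicator A (Y \<omega>)) + (K + 1) * prob (Y -` A \<inter> space M)) / (c + (K + 1))"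
  proof -
    have i1: "integrable M (\<lambda>\<omega>. W \<omega> * indicator A (Y \<omega>))"
      using bounded by (intro integrable_const_bound[of _ K]) (auto simp: indicator_def intro: order_trans[OF _ bounded])
    have i2: "integrable M (\<lambda>\<omega>. indicator A (Y \<omega>) :: real)"
      by (intro integrable_const_bound[of _ 1]) (auto simp: indicator_def)
    have "(LINT \<omega>|M. indicator A (Y \<omega>)) = prob (Y -` A \<inter> space M)"
      by (subst Bochner_Integration.integral_cong[OF refl, of M _ "indicator (Y -` A \<inter> space M)"]) (auto simp: indicator_def)
    then show ?thesis using i1 i2 by simp
  qed
  ultimately show ?thesis using pos by (simp add: field_simps)
qed

text \<open>Real and imaginary part of \<open>W\<close> are real weights that satisfy the same
  hypothesis with \<open>Re c\<close> and \<open>Im c\<close>: each is a combination of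
  \<open>W\<close> and its conjugate, and the conjugate satisfies it with
  \<open>cnj c\<close>.\<close>

lemma (in prob_space) weighted_Levy_uniqueness:
  fixes W :: "'a \<Rightarrow> complex" and Y :: "'a \<Rightarrow> real" and c :: complex and K :: real
  assumes [measurable]: "W \<in> borel_measurable M" "Y \<in> borel_measurable M" "A \<in> sets borel"
    and bounded: "\<And>\<omega>. cmod (W \<omega>) \<le> K"
    and char_eq: "\<And>t. (CLINT \<omega>|M. W \<omega> * iexp (t * Y \<omega>)) = c * (CLINT \<omega>|M. iexp (t * Y \<omega>))"
  shows "(CLINT \<omega>|M. W \<omega> * indicator A (Y \<omega>)) = c * prob (Y -` A \<inter> space M)"
proof -
  have int_We: "integrable M (\<lambda>\<omega>. W \<omega> * iexp (t * Y \<omega>))" for t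
    using bounded by (intro integrable_const_bound[of _ K]) (auto simp: norm_mult)
  have [measurable]: "(\<lambda>\<omega>. cnj (W \<omega>)) \<in> borel_measurable M"
    by (rule borel_measurable_continuous_on[OF continuous_on_cnj[OF continuous_on_id]]) measurable
  have int_cWe: "integrable M (\<lambda>\<omega>. cnj (W \<omega>) * iexp (t * Y \<omega>))" for t
    using bounded by (intro integrable_const_bound[of _ K]) (auto simp: norm_mult)
  have int_WA: "integrable M (\<lambda>\<omega>. W \<omega> * indicator A (Y \<omega>))"
    using bounded by (intro integrable_const_bound[of _ K])
      (auto simp: norm_mult indicator_def intro: order_trans[OF norm_ge_zero bounded])
  \<comment> \<open>Conjugation turns \<open>t\<close> into \<open>- t\<close>, which is harmless
    because the hypothesis holds for every real argument.\<close>
  have cnj_eq: "(CLINT \<omega>|M. cnj (W \<omega>) * iexp (t * Y \<omega>)) = cnj c * (CLINT \<omega>|M. iexp (t * Y \<omega>))" for t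
  proof -
    have "(CLINT \<omega>|M. cnj (W \<omega>) * iexp (t * Y \<omega>)) = cnj (CLINT \<omega>|M. W \<omega> * iexp (- t * Y \<omega>))"
      by (subst Bochner_Integration.integral_cnj[symmetric]) (simp add: exp_cnj)
    also have "\<dots> = cnj c * (CLINT \<omega>|M. cnj (iexp (- t * Y \<omega>)))"
      by (subst char_eq) (simp only: complex_cnj_mult Bochner_Integration.integral_cnj)
    finally show ?thesis by (simp add: exp_cnj del: Bochner_Integration.integral_cnj)
  qed
  have "(CLINT \<omega>|M. complex_of_real (Re (W \<omega>)) * iexp (t * Y \<omega>)) =
      complex_of_real (Re c) * (CLINT \<omega>|M. iexp (t * Y \<omega>))" for t
  proof -
    have "(CLINT \<omega>|M. complex_of_real (Re (W \<omega>)) * iexp (t * Y \<omega>)) =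
        (CLINT \<omega>|M. (W \<omega> * iexp (t * Y \<omega>) + cnj (W \<omega>) * iexp (t * Y \<omega>)) / 2)"
      by (intro Bochner_Integration.integral_cong) (auto simp: complex_add_cnj simp flip: distrib_right)
    also have "\<dots> = (c + cnj c) * (CLINT \<omega>|M. iexp (t * Y \<omega>)) / 2"
      using int_We int_cWe by (simp add: char_eq cnj_eq distrib_right del: of_real_mult)
    finally show ?thesis by (simp add: complex_add_cnj)
  qed
  from weighted_Levy_uniqueness_real[OF _ _ _ _ this, of A K]
  have Re_eq: "(LINT \<omega>|M. Re (W \<omega>) * indicator A (Y \<omega>)) = Re c * prob (Y -` A \<inter> space M)"
    using abs_Re_le_cmod order_trans[OF _ bounded] by auto
  have Im_conv: "complex_of_real (Im z) = (z - cnj z) / (2 * \<i>)" for z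
    by (simp add: complex_eq_iff)
  have "(CLINT \<omega>|M. complex_of_real (Im (W \<omega>)) * iexp (t * Y \<omega>)) =
      complex_of_real (Im c) * (CLINT \<omega>|M. iexp (t * Y \<omega>))" for t
  proof -
    have "(CLINT \<omega>|M. complex_of_real (Im (W \<omega>)) * iexp (t * Y \<omega>)) =
        (CLINT \<omega>|M. (W \<omega> * iexp (t * Y \<omega>) - cnj (W \<omega>) * iexp (t * Y \<omega>)) / (2 * \<i>))"
      by (intro Bochner_Integration.integral_cong) (auto simp: Im_conv left_diff_distrib)
    also have "\<dots> = (c - cnj c) * (CLINT \<omega>|M. iexp (t * Y \<omega>)) / (2 * \<i>)"
      using int_We int_cWe by (simp add: char_eq cnj_eq left_diff_distrib del: of_real_mult)
    finally show ?thesis by (simp add: Im_conv[of c])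
  qed
  from weighted_Levy_uniqueness_real[OF _ _ _ _ this, of A K]
  have Im_eq: "(LINT \<omega>|M. Im (W \<omega>) * indicator A (Y \<omega>)) = Im c * prob (Y -` A \<inter> space M)"
    using abs_Im_le_cmod order_trans[OF _ bounded] by auto
  have ind: "(indicator A y :: complex) = complex_of_real (indicator A y)" for y
    by (simp add: indicator_def)
  show ?thesis
    using int_WA Re_eq Im_eq by (intro complex_eqI) (simp_all add: ind flip: integral_Re integral_Im)
qed

text \<open>The law is the image of the standard normal law under the affine map
  \<open>\<mu> + \<sigma> * x\<close>, so its characteristic function comes from the standard one by
  rescaling and a phase factor.\<close>

lemma char_normal_density:
  assumes "\<sigma> > 0"
  shows "char (density lborel (normal_density \<mu> \<sigma>)) t = exp (\<i> * (t * \<mu>) - (\<sigma> * t)\<^sup>2 / 2)"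
proof -
  interpret S: prob_space std_normal_distribution
    by (rule prob_space_normal_density) simp
  have "distributed std_normal_distribution lborel (\<lambda>x. x) std_normal_density"
    by (simp add: distributed_def distr_id2)
  from S.normal_density_affine[OF this, of \<sigma> \<mu>] assms
  have "distributed std_normal_distribution lborel (\<lambda>x. \<mu> + \<sigma> * x) (normal_density \<mu> \<sigma>)" by simp
  then have "density lborel (normal_density \<mu> \<sigma>) = distr std_normal_distribution lborel (\<lambda>x. \<mu> + \<sigma> * x)"
    by (simp add: distributed_def)
  then have "char (density lborel (normal_density \<mu> \<sigma>)) t = (CLINT x|std_normal_distribution. iexp (t * \<mu>) * iexp (t * \<sigma> * x))"
    by (simp add: char_def integral_distr algebra_simps exp_add)
  also have "\<dots> = iexp (t * \<mu>) * char std_normal_distribution (t * \<sigma>)"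
    by (simp add: char_def)
  also have "\<dots> = exp (\<i> * (t * \<mu>) - (\<sigma> * t)\<^sup>2 / 2)"
    by (simp add: char_std_normal_distribution power_mult_distrib mult.commute
        flip: exp_of_real exp_add)
  finally show ?thesis .
qed

section \<open>Gaussian variables, point masses included: moments and characteristic
  functions\<close>

lemma gaussian_rv_measurable: "gaussian_rv M X \<Longrightarrow> X \<in> borel_measurable M"
  by (simp add: gaussian_rv_def)

context prob_space
begin

lemma gaussian_rv_square_integrable:
  assumes "gaussian_rv M X"
  shows "integrable M (\<lambda>\<omega>. (X \<omega>)\<^sup>2)"
proof -
  have [measurable]: "X \<in> borel_measurable M" using assms by (rule gaussian_rv_measurable)
  from assms consider \<mu> where "AE \<omega> in M. X \<omega> = \<mu>"
    | \<mu> \<sigma> where "\<sigma> > 0" "distributed M lborel X (normal_density \<mu> \<sigma>)"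
    unfolding gaussian_rv_def by blast
  then show ?thesis
  proof cases
    case 1
    then show ?thesis by (intro integrable_const_bound[of _ "\<mu>\<^sup>2"]) auto
  next
    case 2
    \<comment> \<open>The integrand is the expansion of the square of \<open>x\<close> around
      \<open>\<mu>\<close>, in terms of moments known to exist.\<close>
    have "integrable lborel (\<lambda>x. normal_density \<mu> \<sigma> x * (x - \<mu>)\<^sup>2 + 2 * \<mu> * (normal_density \<mu> \<sigma> x * x)
        - \<mu>\<^sup>2 * normal_density \<mu> \<sigma> x)"
      using 2(1) integrable_normal_moment[of \<sigma> \<mu> 2] integrable_normal_moment_nz_1[of \<sigma> \<mu>]
      by (intro Bochner_Integration.integrable_diff Bochner_Integration.integrable_add) auto
    also have "(\<lambda>x. normal_density \<mu> \<sigma> x * (x - \<mu>)\<^sup>2 + 2 * \<mu> * (normal_density \<mu> \<sigma> x * x)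
        - \<mu>\<^sup>2 * normal_density \<mu> \<sigma> x) = (\<lambda>x. normal_density \<mu> \<sigma> x * x\<^sup>2)"
      by (intro ext) (simp add: power2_eq_square algebra_simps)
    finally show ?thesis
      using distributed_integrable[OF 2(2), of "\<lambda>x. x\<^sup>2"] by simp
  qed
qed

lemma gaussian_rv_integrable:
  assumes "gaussian_rv M X"
  shows "integrable M X"
  using square_integrable_imp_integrable gaussian_rv_square_integrable[OF assms] gaussian_rv_measurable[OF assms]
  by blast

text \<open>With the variance \<open>s \<ge> 0\<close> as parameter, one formula covers both kinds
  of Gaussian law: Levy uniqueness yields a point mass at \<open>\<mu>\<close> for
  \<open>s = 0\<close> and a normal density otherwise.\<close>

lemma gaussian_rvI_char:
  assumes [measurable]: "X \<in> borel_measurable M"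
    and "s \<ge> 0" and char_eq: "\<And>t. char (distr M borel X) t = exp (\<i> * (t * \<mu>) - s * t\<^sup>2 / 2)"
  shows "gaussian_rv M X"
proof (cases "s = 0")
  case True
  have "real_distribution (distr M borel X)" by (rule real_distribution_distr) simp
  moreover have "real_distribution (return borel \<mu>)"
    by (simp add: real_distribution_def real_distribution_axioms_def prob_space_return)
  moreover have "char (distr M borel X) = char (return borel \<mu>)"
    by (intro ext, subst char_eq) (simp add: True char_def integral_return)
  ultimately have eq: "distr M borel X = return borel \<mu>" by (rule Levy_uniqueness)
  have "AE x in distr M borel X. x = \<mu>"
    unfolding eq by (simp add: AE_return)
  then have "AE \<omega> in M. X \<omega> = \<mu>" by (simp add: AE_distr_iff)
  then show ?thesis unfolding gaussian_rv_def by auto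
next
  case False
  with assms(2) have s: "s > 0" by simp
  have "real_distribution (distr M borel X)" by (rule real_distribution_distr) simp
  moreover have "real_distribution (density lborel (normal_density \<mu> (sqrt s)))"
    using prob_space_normal_density[of "sqrt s" \<mu>] s
    by (simp add: real_distribution_def real_distribution_axioms_def)
  moreover have "char (distr M borel X) = char (density lborel (normal_density \<mu> (sqrt s)))"
    using s by (simp add: fun_eq_iff char_eq char_normal_density power_mult_distrib flip: of_real_power)
  ultimately have "distr M borel X = density lborel (normal_density \<mu> (sqrt s))" by (rule Levy_uniqueness)
  \<comment> \<open>Densities refer to \<open>lborel\<close> and characteristic functions to
    \<open>borel\<close>; both carry the same sigma-algebra.\<close>
  moreover have "distr M lborel X = distr M borel X" by (rule distr_cong) simp_all
  ultimately have "distributed M lborel X (normal_density \<mu> (sqrt s))"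
    by (simp add: distributed_def)
  then show ?thesis unfolding gaussian_rv_def using s by auto
qed

lemma gaussian_rv_char:
  assumes "gaussian_rv M X"
  shows "char (distr M borel X) t = exp (\<i> * (t * expectation X) - variance X * t\<^sup>2 / 2)"
proof -
  have [measurable]: "X \<in> borel_measurable M" using assms by (rule gaussian_rv_measurable)
  from assms consider \<mu> where "AE \<omega> in M. X \<omega> = \<mu>"
    | \<mu> \<sigma> where "\<sigma> > 0" "distributed M lborel X (normal_density \<mu> \<sigma>)"
    unfolding gaussian_rv_def by blast
  then show ?thesis
  proof cases
    case 1
    have E: "expectation X = \<mu>"
      using 1 by (subst integral_cong_AE[of _ _ "\<lambda>_. \<mu>"]) (auto simp: prob_space)
    have V: "variance X = 0"
      unfolding E using 1 by (subst integral_cong_AE[of _ _ "\<lambda>_. 0"]) auto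
    have "char (distr M borel X) t = (CLINT \<omega>|M. iexp (t * X \<omega>))"
      by (simp add: char_def integral_distr)
    also have "\<dots> = (CLINT \<omega>|M. iexp (t * \<mu>))"
      using 1 by (intro integral_cong_AE) auto
    finally show ?thesis unfolding V by (simp add: E prob_space)
  next
    case 2
    have "distr M borel X = distr M lborel X" by (rule distr_cong) simp_all
    also have "\<dots> = density lborel (normal_density \<mu> \<sigma>)"
      using 2(2) by (simp add: distributed_def)
    finally show ?thesis
      using 2 normal_distributed_expectation[OF 2] normal_distributed_variance[OF 2]
      by (simp add: char_normal_density power_mult_distrib)
  qed
qed

text \<open>Characteristic functions of independent summands multiply, so means and variances add in
  the exponent and the Gaussian form is preserved.\<close>

lemma gaussian_rv_sum_indep:
  assumes indep: "indep_vars (\<lambda>_. borel) X I" and "finite I"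
    and gaussian: "\<And>i. i \<in> I \<Longrightarrow> gaussian_rv M (X i)"
  shows "gaussian_rv M (\<lambda>\<omega>. \<Sum>i\<in>I. X i \<omega>)"
proof (rule gaussian_rvI_char)
  show "(\<lambda>\<omega>. \<Sum>i\<in>I. X i \<omega>) \<in> borel_measurable M"
    using gaussian gaussian_rv_measurable by (intro borel_measurable_sum) blast
  show "0 \<le> (\<Sum>i\<in>I. variance (X i))"
    by (intro sum_nonneg) simp
  show "char (distr M borel (\<lambda>\<omega>. \<Sum>i\<in>I. X i \<omega>)) t =
      exp (\<i> * (t * (\<Sum>i\<in>I. expectation (X i))) - (\<Sum>i\<in>I. variance (X i)) * t\<^sup>2 / 2)" for t
    using \<open>finite I\<close>
    by (simp add: char_distr_sum[OF indep] gaussian gaussian_rv_char sum_distrib_left sum_distrib_right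
        sum_divide_distrib flip: exp_sum sum_subtractf)
qed

end

section \<open>Independence of uncorrelated jointly Gaussian variables\<close>

lemma integrable_mult_of_squares:
  fixes f g :: "'a \<Rightarrow> real"
  assumes [measurable]: "f \<in> borel_measurable M" "g \<in> borel_measurable M"
    and "integrable M (\<lambda>x. (f x)\<^sup>2)" "integrable M (\<lambda>x. (g x)\<^sup>2)"
  shows "integrable M (\<lambda>x. f x * g x)"
proof (rule Bochner_Integration.integrable_bound)
  show "integrable M (\<lambda>x. (f x)\<^sup>2 + (g x)\<^sup>2)" using assms by simp
  have "\<bar>a * b\<bar> \<le> a\<^sup>2 + b\<^sup>2" for a b :: real
    using sum_squares_bound[of "\<bar>a\<bar>" "\<bar>b\<bar>"] mult_nonneg_nonneg[OF abs_ge_zero[of a] abs_ge_zero[of b]]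
    unfolding abs_mult power2_abs by linarith
  then show "AE x in M. norm (f x * g x) \<le> norm ((f x)\<^sup>2 + (g x)\<^sup>2)"
    by (intro AE_I2) (simp add: order_trans[OF _ abs_ge_self])
qed measurable

lemma jointly_gaussianD:
  assumes "jointly_gaussian M I X" "i \<in> I"
  shows "gaussian_rv M (X i)"
  using assms(1)[unfolded jointly_gaussian_def, rule_format, of "{i}" "\<lambda>_. 1"] assms(2) by simp

text \<open>The definition allows each index only once. Here \<open>f\<close> may repeat indices,
  and the coefficients belonging to the same index are collected.\<close>

lemma jointly_gaussian_linear_combination:
  assumes X: "jointly_gaussian M I X" and "finite S" and f: "f ` S \<subseteq> I"
  shows "gaussian_rv M (\<lambda>\<omega>. \<Sum>s\<in>S. c s * X (f s) \<omega>)"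
proof -
  have "(\<Sum>s\<in>S. c s * X (f s) \<omega>) = (\<Sum>i\<in>f ` S. (\<Sum>s | s \<in> S \<and> f s = i. c s) * X i \<omega>)" for \<omega>
    by (subst sum.image_gen[OF \<open>finite S\<close>, of _ f]) (simp add: sum_distrib_right)
  then show ?thesis
    using X f \<open>finite S\<close> unfolding jointly_gaussian_def by simp
qed

context prob_space
begin

lemma gaussian_rv_mult_integrable:
  assumes "gaussian_rv M X" "gaussian_rv M Y"
  shows "integrable M (\<lambda>\<omega>. X \<omega> * Y \<omega>)"
  using assms by (intro integrable_mult_of_squares gaussian_rv_measurable gaussian_rv_square_integrable)

lemma variance_sum_uncorrelated:
  fixes a :: "'i \<Rightarrow> real"
  assumes "finite T" and gaussian: "\<And>i. i \<in> T \<Longrightarrow> gaussian_rv M (X i)"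
    and uncorrelated: "\<And>i j. i \<in> T \<Longrightarrow> j \<in> T \<Longrightarrow> i \<noteq> j \<Longrightarrow> covariance M (X i) (X j) = 0"
  shows "variance (\<lambda>\<omega>. \<Sum>i\<in>T. a i * X i \<omega>) = (\<Sum>i\<in>T. (a i)\<^sup>2 * variance (X i))"
proof -
  define Y where "Y i \<omega> = X i \<omega> - expectation (X i)" for i \<omega>
  have int_Y: "integrable M (\<lambda>\<omega>. Y i \<omega> * Y j \<omega>)" if "i \<in> T" "j \<in> T" for i j
  proof -
    have "integrable M (\<lambda>\<omega>. X i \<omega> * X j \<omega> - X i \<omega> * expectation (X j) - expectation (X i) * X j \<omega> + expectation (X i) * expectation (X j))"
      using that gaussian by (simp add: gaussian_rv_mult_integrable gaussian_rv_integrable)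
    then show ?thesis unfolding Y_def by (simp add: algebra_simps)
  qed
  have "variance (\<lambda>\<omega>. \<Sum>i\<in>T. a i * X i \<omega>) = expectation (\<lambda>\<omega>. (\<Sum>i\<in>T. a i * Y i \<omega>)\<^sup>2)"
    using gaussian by (simp add: gaussian_rv_integrable Y_def right_diff_distrib sum_subtractf)
  also have "\<dots> = expectation (\<lambda>\<omega>. \<Sum>i\<in>T. \<Sum>j\<in>T. a i * a j * (Y i \<omega> * Y j \<omega>))"
    by (simp add: power2_eq_square sum_product mult_ac)
  also have "\<dots> = (\<Sum>i\<in>T. \<Sum>j\<in>T. a i * a j * expectation (\<lambda>\<omega>. Y i \<omega> * Y j \<omega>))"
    by (simp add: int_Y)
  also have "\<dots> = (\<Sum>i\<in>T. \<Sum>j\<in>T. if i = j then (a i)\<^sup>2 * variance (X i) else 0)"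
    using uncorrelated by (intro sum.cong) (auto simp: Y_def covariance_def power2_eq_square)
  finally show ?thesis using \<open>finite T\<close> by simp
qed

text \<open>The joint characteristic function factorises: the combination is Gaussian, so only its
  mean and variance enter, and both are additive when the variables are uncorrelated.\<close>

lemma expectation_iexp_uncorrelated:
  fixes a :: "'i \<Rightarrow> real"
  assumes X: "jointly_gaussian M I X" and "finite T" "T \<subseteq> I"
    and uncorrelated: "\<And>i j. i \<in> I \<Longrightarrow> j \<in> I \<Longrightarrow> i \<noteq> j \<Longrightarrow> covariance M (X i) (X j) = 0"
  shows "expectation (\<lambda>\<omega>. iexp (\<Sum>i\<in>T. a i * X i \<omega>)) = (\<Prod>i\<in>T. expectation (\<lambda>\<omega>. iexp (a i * X i \<omega>)))"
proof -
  have char_eq: "expectation (\<lambda>\<omega>. iexp (t * Y \<omega>)) = exp (\<i> * (t * expectation Y) - variance Y * t\<^sup>2 / 2)"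
    if "gaussian_rv M Y" for t Y
    using gaussian_rv_char[OF that, of t] gaussian_rv_measurable[OF that] by (simp add: char_def integral_distr)
  have G: "gaussian_rv M (X i)" if "i \<in> T" for i
    using jointly_gaussianD[OF X] that \<open>T \<subseteq> I\<close> by blast
  have "gaussian_rv M (\<lambda>\<omega>. \<Sum>i\<in>T. a i * X i \<omega>)"
    using X assms(2,3) unfolding jointly_gaussian_def by blast
  moreover have "expectation (\<lambda>\<omega>. \<Sum>i\<in>T. a i * X i \<omega>) = (\<Sum>i\<in>T. a i * expectation (X i))"
    using G by (simp add: gaussian_rv_integrable)
  moreover have "variance (\<lambda>\<omega>. \<Sum>i\<in>T. a i * X i \<omega>) = (\<Sum>i\<in>T. (a i)\<^sup>2 * variance (X i))"
    using G uncorrelated assms(2,3) by (intro variance_sum_uncorrelated) auto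
  \<comment> \<open>The joint characteristic function at \<open>a\<close> is that of the single
    variable \<open>\<Sum>i\<in>T. a i * X i\<close> at 1.\<close>
  ultimately have "expectation (\<lambda>\<omega>. iexp (\<Sum>i\<in>T. a i * X i \<omega>)) =
      exp (\<i> * complex_of_real (\<Sum>i\<in>T. a i * expectation (X i)) - complex_of_real (\<Sum>i\<in>T. (a i)\<^sup>2 * variance (X i)) / 2)"
    using char_eq[of _ 1] by (simp del: of_real_sum of_real_mult of_real_power)
  also have "\<dots> = (\<Prod>i\<in>T. exp (\<i> * (a i * expectation (X i)) - variance (X i) * (a i)\<^sup>2 / 2))"
    using \<open>finite T\<close>
    by (simp add: sum_distrib_left sum_divide_distrib mult_ac flip: exp_sum sum_subtractf)
  also have "\<dots> = (\<Prod>i\<in>T. expectation (\<lambda>\<omega>. iexp (a i * X i \<omega>)))"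
    using G by (intro prod.cong refl) (simp only: char_eq)
  finally show ?thesis .
qed

text \<open>The identity \<open>mixed\<close> interpolates between two statements: for empty
  \<open>S\<close> it is the factorisation of the joint characteristic function, for empty
  \<open>T\<close> the product rule for probabilities.\<close>

theorem jointly_gaussian_uncorrelated_imp_indep_vars:
  assumes X: "jointly_gaussian M I X"
    and uncorrelated: "\<And>i j. i \<in> I \<Longrightarrow> j \<in> I \<Longrightarrow> i \<noteq> j \<Longrightarrow> covariance M (X i) (X j) = 0"
  shows "indep_vars (\<lambda>_. borel) X I"
proof -
  have rv: "X i \<in> borel_measurable M" if "i \<in> I" for i
    using jointly_gaussianD[OF X that] by (rule gaussian_rv_measurable)
  \<comment> \<open>The exponentials are replaced by indicators one variable at a time, so that uniqueness is
    only needed for characteristic functions on the real line.\<close>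
  have mixed: "expectation (\<lambda>\<omega>. (\<Prod>i\<in>S. indicator (B i) (X i \<omega>)) * iexp (\<Sum>i\<in>T. a i * X i \<omega>)) =
      (\<Prod>i\<in>S. complex_of_real (prob (X i -` B i \<inter> space M))) * (\<Prod>i\<in>T. expectation (\<lambda>\<omega>. iexp (a i * X i \<omega>)))"
    if "finite S" "finite T" "S \<inter> T = {}" "S \<union> T \<subseteq> I" "\<And>i. i \<in> S \<Longrightarrow> B i \<in> sets borel" for S T B a
    using that
  proof (induction S arbitrary: T a rule: finite_induct)
    case empty
    then show ?case using expectation_iexp_uncorrelated[OF X _ _ uncorrelated] by simp
  next
    case (insert s S)
    define W where "W \<omega> = (\<Prod>i\<in>S. indicator (B i) (X i \<omega>)) * iexp (\<Sum>i\<in>T. a i * X i \<omega>)" for \<omega>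
    define c where "c = (\<Prod>i\<in>S. complex_of_real (prob (X i -` B i \<inter> space M))) * (\<Prod>i\<in>T. expectation (\<lambda>\<omega>. iexp (a i * X i \<omega>)))"
    have "s \<notin> T" "s \<in> I" "T \<subseteq> I" "S \<subseteq> I" using insert.prems by auto
    have B: "B i \<in> sets borel" if "i \<in> insert s S" for i using insert.prems that by blast
    have [measurable]: "(\<lambda>\<omega>. indicator (B i) (X i \<omega>) :: complex) \<in> borel_measurable M" if "i \<in> S" for i
      using that \<open>S \<subseteq> I\<close> by (intro measurable_compose[OF rv borel_measurable_indicator] B) auto
    have [measurable]: "X i \<in> borel_measurable M" if "i \<in> T" for i
      using that \<open>T \<subseteq> I\<close> rv by blast
    have [measurable]: "W \<in> borel_measurable M"
      unfolding W_def by measurable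
    have "(\<Prod>i\<in>S. cmod (indicator (B i) (X i \<omega>))) \<le> 1" for \<omega>
      by (intro prod_le_1) (auto simp: indicator_def)
    then have W_bounded: "cmod (W \<omega>) \<le> 1" for \<omega>
      unfolding W_def norm_mult prod_norm[symmetric] by simp
    \<comment> \<open>The induction hypothesis is applied with \<open>s\<close> still among the
      exponentials, at a free coefficient \<open>t\<close>; this is why the induction generalises
      over \<open>T\<close> and \<open>a\<close>.\<close>
    have "expectation (\<lambda>\<omega>. W \<omega> * iexp (t * X s \<omega>)) = c * expectation (\<lambda>\<omega>. iexp (t * X s \<omega>))" for t
    proof -
      have "W \<omega> * iexp (t * X s \<omega>) =
          (\<Prod>i\<in>S. indicator (B i) (X i \<omega>)) * iexp (\<Sum>i\<in>insert s T. (a(s := t)) i * X i \<omega>)" for \<omega>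
      proof -
        have "(\<Sum>i\<in>T. (a(s := t)) i * X i \<omega>) = (\<Sum>i\<in>T. a i * X i \<omega>)"
          using \<open>s \<notin> T\<close> by (intro sum.cong) auto
        then show ?thesis
          using \<open>s \<notin> T\<close> \<open>finite T\<close> unfolding W_def by (simp add: exp_add distrib_left)
      qed
      then have "expectation (\<lambda>\<omega>. W \<omega> * iexp (t * X s \<omega>)) =
          (\<Prod>i\<in>S. complex_of_real (prob (X i -` B i \<inter> space M))) *
          (\<Prod>i\<in>insert s T. expectation (\<lambda>\<omega>. iexp ((a(s := t)) i * X i \<omega>)))"
        using insert.IH[of "insert s T" "a(s := t)"] insert.prems insert.hyps by auto
      also have "(\<Prod>i\<in>insert s T. expectation (\<lambda>\<omega>. iexp ((a(s := t)) i * X i \<omega>))) =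
          expectation (\<lambda>\<omega>. iexp (t * X s \<omega>)) * (\<Prod>i\<in>T. expectation (\<lambda>\<omega>. iexp ((a(s := t)) i * X i \<omega>)))"
        using \<open>s \<notin> T\<close> \<open>finite T\<close> by simp
      also have "(\<Prod>i\<in>T. expectation (\<lambda>\<omega>. iexp ((a(s := t)) i * X i \<omega>))) = (\<Prod>i\<in>T. expectation (\<lambda>\<omega>. iexp (a i * X i \<omega>)))"
        using \<open>s \<notin> T\<close> by (intro prod.cong) auto
      finally show ?thesis by (simp add: c_def mult_ac)
    qed
    from weighted_Levy_uniqueness[OF _ _ _ W_bounded this, of "B s"] rv[OF \<open>s \<in> I\<close>] B
    have "expectation (\<lambda>\<omega>. W \<omega> * indicator (B s) (X s \<omega>)) = c * prob (X s -` B s \<inter> space M)"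
      by simp
    then show ?case using insert.hyps by (simp add: W_def c_def mult_ac)
  qed
  have "prob (\<Inter>i\<in>J. A i) = (\<Prod>i\<in>J. prob (A i))"
    if J: "J \<subseteq> I" "J \<noteq> {}" "finite J" and A: "\<forall>i\<in>J. A i \<in> {X i -` B \<inter> space M | B. B \<in> sets borel}" for J A
  proof -
    from A obtain B where B: "\<And>i. i \<in> J \<Longrightarrow> A i = X i -` B i \<inter> space M" "\<And>i. i \<in> J \<Longrightarrow> B i \<in> sets borel"
      by simp metis
    have A_sets: "A i \<in> sets M" if "i \<in> J" for i
      unfolding B(1)[OF that] using that J B by (intro measurable_sets[OF rv]) auto
    \<comment> \<open>With no exponentials left, the product of indicators is the indicator of the
      intersection.\<close>
    have "expectation (\<lambda>\<omega>. \<Prod>i\<in>J. indicator (B i) (X i \<omega>)) = (\<Prod>i\<in>J. complex_of_real (prob (A i)))"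
      using mixed[of J "{}" B] J B by simp
    moreover have "(\<Prod>i\<in>J. indicator (B i) (X i \<omega>)) = complex_of_real (indicator (\<Inter>i\<in>J. A i) \<omega>)" if "\<omega> \<in> space M" for \<omega>
      using B that J by (auto simp: indicator_def prod_zero_iff)
    ultimately have "complex_of_real (expectation (indicator (\<Inter>i\<in>J. A i))) = complex_of_real (\<Prod>i\<in>J. prob (A i))"
      by (simp cong: Bochner_Integration.integral_cong)
    moreover have "(\<Inter>i\<in>J. A i) \<inter> space M = (\<Inter>i\<in>J. A i)" using J(2) B(1) by blast
    ultimately show ?thesis
      unfolding of_real_eq_iff by simp
  qed
  then have "indep_sets (\<lambda>i. {X i -` B \<inter> space M | B. B \<in> sets borel}) I"
    using rv by (intro indep_setsI) (auto intro!: measurable_sets)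
  then show ?thesis
    unfolding indep_vars_def2 using rv by blast
qed

end

section \<open>Strict positive definiteness of the fractional Brownian covariance\<close>

text \<open>Away from 0 the power is smooth, so its second difference is of order
  \<open>x\<^sup>2\<close>, which is negligible against \<open>x powr p\<close> for
  \<open>p < 2\<close>.\<close>

lemma second_difference_powr:
  fixes a p :: real
  assumes "a > 0" "p < 2"
  shows "((\<lambda>x. ((a + x) powr p - 2 * a powr p + (a - x) powr p) / x powr p) \<longlongrightarrow> 0) (at_right 0)"
proof (rule Lim_transform_eventually)
  \<comment> \<open>The limit is the second derivative
    \<open>p * (p - 1) * a powr (p - 2)\<close>.\<close>
  have "((\<lambda>x. ((a + x) powr p - 2 * a powr p + (a - x) powr p) / x\<^sup>2) \<longlongrightarrow>
      p * (inverse a * (inverse a * ((p - 1) * a powr p)))) (at_right 0)"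
    using \<open>a > 0\<close> by real_asymp
  moreover have "((\<lambda>x. x\<^sup>2 / x powr p) \<longlongrightarrow> 0) (at_right 0)"
    using \<open>p < 2\<close> by real_asymp
  ultimately show "((\<lambda>x. ((a + x) powr p - 2 * a powr p + (a - x) powr p) / x\<^sup>2 * (x\<^sup>2 / x powr p)) \<longlongrightarrow> 0) (at_right 0)"
    using tendsto_mult_zero by (auto dest: tendsto_mult)
  show "\<forall>\<^sub>F x in at_right 0. ((a + x) powr p - 2 * a powr p + (a - x) powr p) / x\<^sup>2 * (x\<^sup>2 / x powr p) =
      ((a + x) powr p - 2 * a powr p + (a - x) powr p) / x powr p"
    using eventually_at_right_less[of 0] by eventually_elim simp
qed

lemma second_difference_abs_powr:
  fixes a b p :: real
  assumes "a \<noteq> b" "p < 2"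
  shows "((\<lambda>x. (\<bar>a + x - b\<bar> powr p - 2 * \<bar>a - b\<bar> powr p + \<bar>a - x - b\<bar> powr p) / x powr p) \<longlongrightarrow> 0) (at_right 0)"
proof (rule Lim_transform_eventually)
  show "((\<lambda>x. ((\<bar>a - b\<bar> + x) powr p - 2 * \<bar>a - b\<bar> powr p + (\<bar>a - b\<bar> - x) powr p) / x powr p) \<longlongrightarrow> 0) (at_right 0)"
    using assms by (intro second_difference_powr) auto
  have "\<forall>\<^sub>F x in at_right 0. 0 < x \<and> x < \<bar>a - b\<bar>"
    using assms(1) by (intro eventually_at_right_real[THEN eventually_mono]) auto
  then show "\<forall>\<^sub>F x in at_right 0.
      ((\<bar>a - b\<bar> + x) powr p - 2 * \<bar>a - b\<bar> powr p + (\<bar>a - b\<bar> - x) powr p) / x powr p =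
      (\<bar>a + x - b\<bar> powr p - 2 * \<bar>a - b\<bar> powr p + \<bar>a - x - b\<bar> powr p) / x powr p"
  proof eventually_elim
    case (elim x)
    show ?case
    proof (cases "a > b")
      case True
      then show ?thesis using elim by (simp add: algebra_simps)
    next
      case False
      \<comment> \<open>For \<open>a < b\<close> the step \<open>+ x\<close> moves towards
        \<open>b\<close>, so the two outer terms change places.\<close>
      then have "\<bar>a + x - b\<bar> = \<bar>a - b\<bar> - x" "\<bar>a - x - b\<bar> = \<bar>a - b\<bar> + x" using elim by auto
      then show ?thesis by simp
    qed
  qed
qed

text \<open>The second difference of \<open>\<bar>s - t\<^sub>k\<bar> powr 2H\<close> at \<open>t\<^sub>k\<close> with step \<open>x\<close> is \<open>2 x powr 2H\<close>, while
  those of all other terms are \<open>O(x\<^sup>2)\<close>.\<close>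

lemma fbm_cov_linear_independent:
  fixes c t :: "'i \<Rightarrow> real"
  assumes H: "0 < H" "H < 1" and "finite I" and "inj_on t I" and pos: "\<And>i. i \<in> I \<Longrightarrow> t i > 0"
    and vanish: "\<And>s. s \<ge> 0 \<Longrightarrow> (\<Sum>i\<in>I. c i * fbm_cov H (t i) s) = 0" and "k \<in> I"
  shows "c k = 0"
proof -
  define p where "p = 2 * H"
  have p: "0 < p" "p < 2" using H by (auto simp: p_def)
  define a where "a = t k"
  have a: "a > 0" using pos \<open>k \<in> I\<close> by (simp add: a_def)
  define D where "D f x = (f (a + x) - 2 * f a + f (a - x)) / x powr p" for f :: "real \<Rightarrow> real" and x
  define g where "g b s = \<bar>s - b\<bar> powr p" for b s :: real
  have D_g: "(D (g b) \<longlongrightarrow> 0) (at_right 0)" if "b \<noteq> a" for b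
    using second_difference_abs_powr[of a b p] that p unfolding D_def g_def by simp
  have D_ga: "D (g a) x = 2" if "x > 0" for x
    using that by (simp add: D_def g_def)
  \<comment> \<open>Steps shorter than \<open>a\<close> keep \<open>a - x\<close> nonnegative, where
    the covariances are assumed to vanish.\<close>
  have ev: "\<forall>\<^sub>F x in at_right 0. 0 < x \<and> x < a"
    using a by (intro eventually_at_right_real[THEN eventually_mono]) auto
  \<comment> \<open>On \<open>s \<ge> 0\<close> this is twice the vanishing sum of covariances. The
    terms \<open>t i powr p\<close> are constant in \<open>s\<close> and drop out of second
    differences.\<close>
  define h where "h s = (\<Sum>i\<in>I. c i * (t i powr p + g 0 s - g (t i) s))" for s
  have h0: "h s = 0" if "s \<ge> 0" for s
  proof -
    have "h s = 2 * (\<Sum>i\<in>I. c i * fbm_cov H (t i) s)"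
      unfolding h_def sum_distrib_left using that
      by (intro sum.cong) (auto simp: fbm_cov_def g_def p_def)
    then show ?thesis using vanish[OF that] by simp
  qed
  have "D h x = (\<Sum>i\<in>I. c i * (D (g 0) x - D (g (t i)) x))" for x
  proof -
    have "h (a + x) - 2 * h a + h (a - x) = (\<Sum>i\<in>I. c i * (t i powr p + g 0 (a + x) - g (t i) (a + x))
        - 2 * (c i * (t i powr p + g 0 a - g (t i) a)) + c i * (t i powr p + g 0 (a - x) - g (t i) (a - x)))"
      by (simp only: h_def sum_distrib_left sum.distrib sum_subtractf)
    also have "\<dots> = (\<Sum>i\<in>I. c i * ((g 0 (a + x) - 2 * g 0 a + g 0 (a - x)) -
        (g (t i) (a + x) - 2 * g (t i) a + g (t i) (a - x))))"
      by (intro sum.cong refl) (simp add: algebra_simps)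
    finally show ?thesis
      by (simp add: D_def sum_divide_distrib diff_divide_distrib[symmetric])
  qed
  also have "\<dots> x = (\<Sum>i\<in>I - {k}. c i * (D (g 0) x - D (g (t i)) x)) + c k * (D (g 0) x - D (g a) x)" for x
    using \<open>finite I\<close> \<open>k \<in> I\<close> by (simp add: sum.remove a_def)
  finally have D_h: "D h x = (\<Sum>i\<in>I - {k}. c i * (D (g 0) x - D (g (t i)) x)) + c k * (D (g 0) x - D (g a) x)" for x .
  \<comment> \<open>Only the singularity at \<open>t k\<close> survives in the limit, since
    \<open>g 0\<close> is smooth at \<open>a > 0\<close> and the other times differ from
    \<open>a\<close> by injectivity. The limit \<open>- 2 * c k\<close> must equal 0.\<close>
  have "((\<lambda>x. (\<Sum>i\<in>I - {k}. c i * (D (g 0) x - D (g (t i)) x)) + c k * (D (g 0) x - 2)) \<longlongrightarrow>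
      (\<Sum>i\<in>I - {k}. c i * (0 - 0)) + c k * (0 - 2)) (at_right 0)"
    using a \<open>inj_on t I\<close> \<open>k \<in> I\<close>
    by (intro tendsto_intros D_g) (auto simp: a_def inj_on_def)
  moreover have "\<forall>\<^sub>F x in at_right 0. (\<Sum>i\<in>I - {k}. c i * (D (g 0) x - D (g (t i)) x)) + c k * (D (g 0) x - 2) = 0"
    using ev
  proof eventually_elim
    case (elim x)
    have "D h x = 0" using elim a by (simp add: D_def h0)
    then show ?case using elim D_h[of x] by (simp add: D_ga)
  qed
  ultimately have "((\<lambda>_. 0) \<longlongrightarrow> (\<Sum>i\<in>I - {k}. c i * (0 - 0)) + c k * (0 - 2)) (at_right (0::real))"
    by (rule Lim_transform_eventually)
  then show ?thesis by (simp add: tendsto_const_iff)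
qed

text \<open>The quadratic form is the second moment of the combination \<open>S\<close>. If it is 0,
  then \<open>S\<close> vanishes almost surely and is orthogonal to every \<open>B s\<close>, to
  which linear independence of the covariances applies.\<close>

lemma (in prob_space) fbm_positive_definite:
  fixes c t :: "'i \<Rightarrow> real"
  assumes B: "fractional_brownian_motion M H B" and H: "0 < H" "H < 1"
    and "finite I" "inj_on t I" and pos: "\<And>i. i \<in> I \<Longrightarrow> t i > 0"
  shows "(\<Sum>i\<in>I. \<Sum>j\<in>I. c i * c j * fbm_cov H (t i) (t j)) \<ge> 0"
    and "(\<Sum>i\<in>I. \<Sum>j\<in>I. c i * c j * fbm_cov H (t i) (t j)) = 0 \<Longrightarrow> k \<in> I \<Longrightarrow> c k = 0"
proof -
  have G: "gaussian_rv M (B s)" if "s \<ge> 0" for s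
    using B that jointly_gaussianD[of M "{0..}" B s] unfolding fractional_brownian_motion_def by simp
  have cov: "expectation (\<lambda>\<omega>. B s \<omega> * B u \<omega>) = fbm_cov H u s" if "s \<ge> 0" "u \<ge> 0" for s u
    using B that unfolding fractional_brownian_motion_def by simp
  define S where "S \<omega> = (\<Sum>i\<in>I. c i * B (t i) \<omega>)" for \<omega>
  have [simp]: "t i \<ge> 0" if "i \<in> I" for i using pos[OF that] by simp
  have "(S \<omega>)\<^sup>2 = (\<Sum>i\<in>I. \<Sum>j\<in>I. c i * c j * (B (t i) \<omega> * B (t j) \<omega>))" for \<omega>
    by (simp add: S_def power2_eq_square sum_product mult_ac)
  then have "expectation (\<lambda>\<omega>. (S \<omega>)\<^sup>2) = (\<Sum>i\<in>I. \<Sum>j\<in>I. c i * c j * fbm_cov H (t j) (t i))"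
    by (simp add: gaussian_rv_mult_integrable G cov)
  then have E2: "expectation (\<lambda>\<omega>. (S \<omega>)\<^sup>2) = (\<Sum>i\<in>I. \<Sum>j\<in>I. c i * c j * fbm_cov H (t i) (t j))"
    by (subst sum.swap) (simp add: mult_ac)
  then show "(\<Sum>i\<in>I. \<Sum>j\<in>I. c i * c j * fbm_cov H (t i) (t j)) \<ge> 0"
    using integral_nonneg_AE[of "\<lambda>\<omega>. (S \<omega>)\<^sup>2" M] by simp
  assume zero: "(\<Sum>i\<in>I. \<Sum>j\<in>I. c i * c j * fbm_cov H (t i) (t j)) = 0" and "k \<in> I"
  have GS: "gaussian_rv M S"
    using jointly_gaussian_linear_combination[of M "{0..}" B I t c] B \<open>finite I\<close> pos
    unfolding fractional_brownian_motion_def S_def by (auto simp: image_subset_iff)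
  have [measurable]: "S \<in> borel_measurable M" using GS by (rule gaussian_rv_measurable)
  have "AE \<omega> in M. (S \<omega>)\<^sup>2 = 0"
    using integral_nonneg_eq_0_iff_AE[OF gaussian_rv_square_integrable[OF GS]] E2 zero by simp
  then have S0: "AE \<omega> in M. S \<omega> = 0" by simp
  show "c k = 0"
  proof (rule fbm_cov_linear_independent[OF H \<open>finite I\<close> \<open>inj_on t I\<close> pos _ \<open>k \<in> I\<close>])
    fix s :: real assume s: "s \<ge> 0"
    have [measurable]: "B s \<in> borel_measurable M" using G[OF s] by (rule gaussian_rv_measurable)
    have "expectation (\<lambda>\<omega>. S \<omega> * B s \<omega>) = expectation (\<lambda>_. 0)"
      using S0 by (intro integral_cong_AE) auto
    moreover have "S \<omega> * B s \<omega> = (\<Sum>i\<in>I. c i * (B s \<omega> * B (t i) \<omega>))" for \<omega>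
      unfolding S_def sum_distrib_right by (intro sum.cong) auto
    ultimately show "(\<Sum>i\<in>I. c i * fbm_cov H (t i) s) = 0"
      using s by (simp add: gaussian_rv_mult_integrable G cov)
  qed
qed

section \<open>Gaussian sequences with covariance depending on the maximum index\<close>

lemma covariance_commute: "covariance M X Y = covariance M Y X"
  unfolding covariance_def by (simp add: mult.commute)

lemma jointly_gaussian_increments:
  assumes X: "jointly_gaussian M I X" and f: "f ` J \<subseteq> I" and g: "g ` J \<subseteq> I"
  shows "jointly_gaussian M J (\<lambda>j \<omega>. X (f j) \<omega> - X (g j) \<omega>)"
  unfolding jointly_gaussian_def
proof (intro allI impI)
  fix K c assume K: "finite K \<and> K \<subseteq> J"
  \<comment> \<open>Each increment is split into two terms tagged by a boolean. Neighbouring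
    increments may share an index, hence the use of combinations with repetition.\<close>
  have "(\<Sum>j\<in>K. c j * (X (f j) \<omega> - X (g j) \<omega>)) =
      (\<Sum>s\<in>K \<times> UNIV. (if snd s then c (fst s) else - c (fst s)) * X ((if snd s then f else g) (fst s)) \<omega>)" for \<omega>
    unfolding sum.cartesian_product' by (intro sum.cong refl) (simp add: UNIV_bool right_diff_distrib)
  moreover have "gaussian_rv M (\<lambda>\<omega>. \<Sum>s\<in>K \<times> UNIV. (if snd s then c (fst s) else - c (fst s)) *
      X ((if snd s then f else g) (fst s)) \<omega>)"
    using K f g by (intro jointly_gaussian_linear_combination[OF X]) (auto simp: image_subset_iff subset_iff)
  ultimately show "gaussian_rv M (\<lambda>\<omega>. \<Sum>j\<in>K. c j * (X (f j) \<omega> - X (g j) \<omega>))"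
    by simp
qed

context prob_space
begin

context
  fixes I :: "'i::linorder set" and X :: "'i \<Rightarrow> 'a \<Rightarrow> real" and v :: "'i \<Rightarrow> real"
  assumes X: "jointly_gaussian M I X"
    and centred: "\<And>i. i \<in> I \<Longrightarrow> expectation (X i) = 0"
    and cov_max: "\<And>i j. i \<in> I \<Longrightarrow> j \<in> I \<Longrightarrow> expectation (\<lambda>\<omega>. X i \<omega> * X j \<omega>) = v (max i j)"
begin

lemma uncorrelated_increments:
  assumes "{i, j, k, l} \<subseteq> I" "i \<le> j" "j \<le> k" "k \<le> l"
  shows "covariance M (\<lambda>\<omega>. X l \<omega> - X k \<omega>) (\<lambda>\<omega>. X j \<omega> - X i \<omega>) = 0"
proof -
  have G: "gaussian_rv M (X n)" if "n \<in> {i, j, k, l}" for n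
    using jointly_gaussianD[OF X] that assms(1) by blast
  have mean: "expectation (\<lambda>\<omega>. X a \<omega> - X b \<omega>) = 0" if "a \<in> {i, j, k, l}" "b \<in> {i, j, k, l}" for a b
  proof -
    have "a \<in> I" "b \<in> I" using that assms(1) by auto
    then show ?thesis using that by (simp add: G gaussian_rv_integrable centred del: insert_iff)
  qed
  have "covariance M (\<lambda>\<omega>. X l \<omega> - X k \<omega>) (\<lambda>\<omega>. X j \<omega> - X i \<omega>) =
      expectation (\<lambda>\<omega>. X l \<omega> * X j \<omega> - X l \<omega> * X i \<omega> - (X k \<omega> * X j \<omega> - X k \<omega> * X i \<omega>))"
    unfolding covariance_def by (simp only: mean insertI1 insertI2) (simp add: algebra_simps)
  also have "\<dots> = v (max l j) - v (max l i) - (v (max k j) - v (max k i))"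
    using assms(1) by (simp add: G gaussian_rv_mult_integrable cov_max)
  \<comment> \<open>Both \<open>i\<close> and \<open>j\<close> lie below \<open>k\<close> and
    \<open>l\<close>, so the four maxima are \<open>l\<close>, \<open>l\<close>, \<open>k\<close>,
    \<open>k\<close> and the values of \<open>v\<close> cancel in pairs.\<close>
  also have "\<dots> = 0" using assms by (simp add: max_absorb1)
  finally show ?thesis .
qed

lemma gaussian_independent_increments: "independent_increments M I X"
  unfolding independent_increments_def
proof (intro allI impI)
  fix k and t :: "nat \<Rightarrow> 'i" assume t: "t ` {..k} \<subseteq> I \<and> mono_on {..k} t"
  \<comment> \<open>For \<open>i < j\<close> monotonicity gives \<open>t (Suc i) \<le> t j\<close>,
    so the two index ranges do not overlap.\<close>
  have cov: "covariance M (\<lambda>\<omega>. X (t (Suc j)) \<omega> - X (t j) \<omega>) (\<lambda>\<omega>. X (t (Suc i)) \<omega> - X (t i) \<omega>) = 0"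
    if "i < j" "j < k" for i j
    using t that by (intro uncorrelated_increments) (auto intro: mono_onD)
  have cov': "covariance M (\<lambda>\<omega>. X (t (Suc i)) \<omega> - X (t i) \<omega>) (\<lambda>\<omega>. X (t (Suc j)) \<omega> - X (t j) \<omega>) = 0"
    if "i < j" "j < k" for i j
    by (subst covariance_commute) (rule cov[OF that])
  show "indep_vars (\<lambda>_. borel) (\<lambda>j \<omega>. X (t (Suc j)) \<omega> - X (t j) \<omega>) {..<k}"
  proof (rule jointly_gaussian_uncorrelated_imp_indep_vars)
    show "jointly_gaussian M {..<k} (\<lambda>j \<omega>. X (t (Suc j)) \<omega> - X (t j) \<omega>)"
      using t by (intro jointly_gaussian_increments[OF X, where f = "\<lambda>j. t (Suc j)"]) auto
    fix i j assume "i \<in> {..<k}" "j \<in> {..<k}" "i \<noteq> j"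
    then show "covariance M (\<lambda>\<omega>. X (t (Suc i)) \<omega> - X (t i) \<omega>) (\<lambda>\<omega>. X (t (Suc j)) \<omega> - X (t j) \<omega>) = 0"
      using cov[of j i] cov'[of i j] by (cases "i < j") auto
  qed
qed

lemma gaussian_independent_two_increments:
  assumes "{i, j, k, l} \<subseteq> I" "i \<le> j" "j \<le> k" "k \<le> l"
  shows "indep_var borel (\<lambda>\<omega>. X l \<omega> - X k \<omega>) borel (\<lambda>\<omega>. X j \<omega> - X i \<omega>)"
proof -
  have cov': "covariance M (\<lambda>\<omega>. X j \<omega> - X i \<omega>) (\<lambda>\<omega>. X l \<omega> - X k \<omega>) = 0"
    by (subst covariance_commute) (rule uncorrelated_increments[OF assms])
  \<comment> \<open>The pair is written as a family over \<open>bool\<close>, the form in which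
    \<open>indep_var\<close> is defined.\<close>
  have "indep_vars (\<lambda>_. borel) (\<lambda>b \<omega>. X (if b then l else j) \<omega> - X (if b then k else i) \<omega>) UNIV"
  proof (rule jointly_gaussian_uncorrelated_imp_indep_vars)
    show "jointly_gaussian M UNIV (\<lambda>b \<omega>. X (if b then l else j) \<omega> - X (if b then k else i) \<omega>)"
      using assms(1) by (intro jointly_gaussian_increments[OF X]) auto
    show "covariance M (\<lambda>\<omega>. X (if b then l else j) \<omega> - X (if b then k else i) \<omega>)
        (\<lambda>\<omega>. X (if b' then l else j) \<omega> - X (if b' then k else i) \<omega>) = 0" if "b \<noteq> b'" for b b'
      using that uncorrelated_increments[OF assms] cov' by (cases b; cases b') simp_all
  qed
  also have "(\<lambda>b \<omega>. X (if b then l else j) \<omega> - X (if b then k else i) \<omega>) =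
      case_bool (\<lambda>\<omega>. X l \<omega> - X k \<omega>) (\<lambda>\<omega>. X j \<omega> - X i \<omega>)"
    by (simp add: fun_eq_iff split: bool.split)
  also have "(\<lambda>_. borel) = case_bool borel borel"
    by (simp add: fun_eq_iff split: bool.split)
  finally show ?thesis unfolding indep_var_def .
qed

end

end

section \<open>The generalised least squares estimator\<close>

text \<open>A singular matrix has a nonzero kernel vector, and the quadratic form would vanish
  there.\<close>

lemma mat_inverse_positive_definite:
  fixes A :: "real Matrix.mat"
  assumes A: "A \<in> carrier_mat n n"
    and definite: "\<And>x. x \<in> carrier_vec n \<Longrightarrow> x \<bullet> (A *\<^sub>v x) = 0 \<Longrightarrow> x = 0\<^sub>v n"
  obtains A' where "mat_inverse A = Some A'" "A' \<in> carrier_mat n n" "A * A' = 1\<^sub>m n" "A' * A = 1\<^sub>m n"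
proof -
  have "det A \<noteq> 0"
  proof
    assume "det A = 0"
    then obtain x where "x \<in> carrier_vec n" "x \<noteq> 0\<^sub>v n" "A *\<^sub>v x = 0\<^sub>v n"
      using det_0_iff_vec_prod_zero_field[OF A] by blast
    then show False using definite[of x] by simp
  qed
  then have "A \<in> Units (ring_mat TYPE(real) n ())"
    by (rule det_non_zero_imp_unit[OF A])
  then obtain A' where "mat_inverse A = Some A'"
    using mat_inverse(1)[OF A, of "()"] by blast
  then show ?thesis using mat_inverse(2)[OF A] that by blast
qed

lemma fbm_cov_commute: "fbm_cov H s t = fbm_cov H t s"
  by (simp add: fbm_cov_def abs_minus_commute)

section \<open>The summed noise: Gaussianity and covariance\<close>

locale mixed_fbm = prob_space M for M :: "'a measure" +
  fixes h :: real and m :: nat and H :: "nat \<Rightarrow> real" and B :: "nat \<Rightarrow> real \<Rightarrow> 'a \<Rightarrow> real"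
  assumes h_pos: "h > 0"
    and m_pos: "m \<ge> 1"
    and Hurst: "r \<in> {1..m} \<Longrightarrow> 0 < H r \<and> H r < 1"
    and fbm: "r \<in> {1..m} \<Longrightarrow> fractional_brownian_motion M (H r) (B r)"
    and indep: "independent_processes M {1..m} B"
begin

definition noise :: "real \<Rightarrow> 'a \<Rightarrow> real" where
  "noise t \<omega> = (\<Sum>r=1..m. B r t \<omega>)"

definition cov :: "real \<Rightarrow> real \<Rightarrow> real" where
  "cov s t = (\<Sum>r=1..m. fbm_cov (H r) s t)"

lemma gaussian_B: "r \<in> {1..m} \<Longrightarrow> t \<ge> 0 \<Longrightarrow> gaussian_rv M (B r t)"
  using fbm jointly_gaussianD[of M "{0..}" "B r" t] unfolding fractional_brownian_motion_def by simp

lemma expectation_B: "r \<in> {1..m} \<Longrightarrow> t \<ge> 0 \<Longrightarrow> expectation (B r t) = 0"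
  using fbm unfolding fractional_brownian_motion_def by simp

text \<open>Passes from independence of whole paths to quantities computed from each path
  separately.\<close>

lemma indep_vars_functional:
  assumes "\<And>r. r \<in> {1..m} \<Longrightarrow> F r \<in> borel_measurable (PiM {0..} (\<lambda>_. borel))"
  shows "indep_vars (\<lambda>_. borel) (\<lambda>r \<omega>. F r (restrict (\<lambda>t. B r t \<omega>) {0..})) {1..m}"
  using indep[unfolded independent_processes_def] assms by (rule indep_vars_compose2)

text \<open>Exchanging the sums over \<open>r\<close> and \<open>t\<close> turns a combination of
  noise values into a sum of independent Gaussian variables, each a functional of one path.\<close>

lemma jointly_gaussian_noise: "jointly_gaussian M {0..} noise"
  unfolding jointly_gaussian_def
proof (intro allI impI)
  fix J :: "real set" and c assume J: "finite J \<and> J \<subseteq> {0..}"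
  have "indep_vars (\<lambda>_. borel) (\<lambda>r \<omega>. \<Sum>t\<in>J. c t * restrict (\<lambda>t. B r t \<omega>) {0..} t) {1..m}"
    using J by (intro indep_vars_functional borel_measurable_sum borel_measurable_times borel_measurable_const
        measurable_component_singleton) auto
  also have "(\<lambda>r \<omega>. \<Sum>t\<in>J. c t * restrict (\<lambda>t. B r t \<omega>) {0..} t) = (\<lambda>r \<omega>. \<Sum>t\<in>J. c t * B r t \<omega>)"
    using J by (intro ext sum.cong) auto
  finally have "indep_vars (\<lambda>_. borel) (\<lambda>r \<omega>. \<Sum>t\<in>J. c t * B r t \<omega>) {1..m}" .
  moreover have "gaussian_rv M (\<lambda>\<omega>. \<Sum>t\<in>J. c t * B r t \<omega>)" if "r \<in> {1..m}" for r
    using fbm[OF that] J unfolding fractional_brownian_motion_def jointly_gaussian_def by blast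
  ultimately have "gaussian_rv M (\<lambda>\<omega>. \<Sum>r=1..m. \<Sum>t\<in>J. c t * B r t \<omega>)"
    by (rule gaussian_rv_sum_indep[OF _ finite_atLeastAtMost])
  also have "(\<lambda>\<omega>. \<Sum>r=1..m. \<Sum>t\<in>J. c t * B r t \<omega>) = (\<lambda>\<omega>. \<Sum>t\<in>J. c t * noise t \<omega>)"
    unfolding noise_def sum_distrib_left by (intro ext sum.swap)
  finally show "gaussian_rv M (\<lambda>\<omega>. \<Sum>t\<in>J. c t * noise t \<omega>)" .
qed

lemma gaussian_noise: "t \<ge> 0 \<Longrightarrow> gaussian_rv M (noise t)"
  using jointly_gaussianD[OF jointly_gaussian_noise] by simp

lemma expectation_noise: "t \<ge> 0 \<Longrightarrow> expectation (noise t) = 0"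
  unfolding noise_def[abs_def] by (simp add: gaussian_rv_integrable gaussian_B expectation_B)

lemma expectation_B_mult:
  assumes "r \<in> {1..m}" "q \<in> {1..m}" "s \<ge> 0" "t \<ge> 0"
  shows "expectation (\<lambda>\<omega>. B r s \<omega> * B q t \<omega>) = (if r = q then fbm_cov (H r) s t else 0)"
proof (cases "r = q")
  case True
  have "expectation (\<lambda>\<omega>. B r s \<omega> * B r t \<omega>) = fbm_cov (H r) t s"
    using fbm[OF assms(1)] assms(3,4) unfolding fractional_brownian_motion_def by blast
  then show ?thesis using True by (simp add: fbm_cov_commute[of _ t s])
next
  case False
  \<comment> \<open>Process \<open>r\<close> is read at time \<open>s\<close> and all others at
    \<open>t\<close>, so that both factors belong to one independent family.\<close>
  define u where "u p = (if p = r then s else t)" for p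
  have "indep_vars (\<lambda>_. borel) (\<lambda>p \<omega>. restrict (\<lambda>t. B p t \<omega>) {0..} (u p)) {1..m}"
    by (rule indep_vars_functional[where F = "\<lambda>p f. f (u p)"])
      (use assms in \<open>auto intro!: measurable_component_singleton simp: u_def\<close>)
  then have ind: "indep_vars (\<lambda>_. borel) (\<lambda>p \<omega>. restrict (\<lambda>t. B p t \<omega>) {0..} (u p)) {r, q}"
    by (rule indep_vars_subset) (use assms in auto)
  have u: "restrict (\<lambda>t. B p t \<omega>) {0..} (u p) = B p (u p) \<omega>" for p \<omega>
    using assms by (simp add: u_def)
  have "expectation (\<lambda>\<omega>. \<Prod>p\<in>{r, q}. B p (u p) \<omega>) = (\<Prod>p\<in>{r, q}. expectation (B p (u p)))"
  proof (rule indep_vars_lebesgue_integral)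
    show "indep_vars (\<lambda>_. borel) (\<lambda>p. B p (u p)) {r, q}" using ind unfolding u .
    show "integrable M (B p (u p))" if "p \<in> {r, q}" for p
      using that assms by (intro gaussian_rv_integrable gaussian_B) (auto simp: u_def)
  qed simp
  then show ?thesis using False assms by (simp add: u_def expectation_B)
qed

lemma expectation_noise_mult:
  assumes "s \<ge> 0" "t \<ge> 0"
  shows "expectation (\<lambda>\<omega>. noise s \<omega> * noise t \<omega>) = cov s t"
proof -
  have int: "integrable M (\<lambda>\<omega>. B r s \<omega> * B q t \<omega>)" if "r \<in> {1..m}" "q \<in> {1..m}" for r q
    using that assms by (intro gaussian_rv_mult_integrable gaussian_B)
  have "expectation (\<lambda>\<omega>. noise s \<omega> * noise t \<omega>) = (\<Sum>r=1..m. \<Sum>q=1..m. expectation (\<lambda>\<omega>. B r s \<omega> * B q t \<omega>))"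
    unfolding noise_def sum_product by (simp add: int del: One_nat_def atLeastAtMost_iff)
  also have "\<dots> = (\<Sum>r=1..m. \<Sum>q=1..m. if r = q then fbm_cov (H r) s t else 0)"
    using assms by (intro sum.cong refl expectation_B_mult)
  finally show ?thesis by (simp add: cov_def)
qed

section \<open>Invertibility of the covariance matrix on the grid\<close>

lemma grid_pos: "grid h (Suc i) > 0"
  using h_pos by (simp add: grid_def)

lemma cov_definite:
  assumes "(\<Sum>i<N. \<Sum>j<N. c i * c j * cov (grid h (Suc i)) (grid h (Suc j))) = 0" "k < N"
  shows "c k = 0"
proof -
  define Q where "Q r = (\<Sum>i<N. \<Sum>j<N. c i * c j * fbm_cov (H r) (grid h (Suc i)) (grid h (Suc j)))" for r
  have inj: "inj_on (\<lambda>i. grid h (Suc i)) {..<N}"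
    using h_pos by (auto simp: inj_on_def grid_def)
  note PD = fbm_positive_definite[OF fbm _ _ finite_lessThan inj grid_pos]
  have Q_nonneg: "Q r \<ge> 0" if "r \<in> {1..m}" for r
    using PD(1)[OF that] Hurst[OF that] unfolding Q_def by simp
  have "(\<Sum>r=1..m. Q r) = (\<Sum>i<N. \<Sum>j<N. c i * c j * cov (grid h (Suc i)) (grid h (Suc j)))"
    unfolding Q_def cov_def sum_distrib_left
    by (subst sum.swap, rule sum.cong[OF refl], rule sum.swap)
  then have "(\<Sum>r=1..m. Q r) = 0" using assms(1) by simp
  \<comment> \<open>Nonnegative forms with sum 0 all vanish; \<open>m \<ge> 1\<close> supplies the
    form at \<open>r = 1\<close>, which is already definite.\<close>
  then have "Q 1 = 0" using Q_nonneg m_pos by (subst (asm) sum_nonneg_eq_0_iff) auto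
  then show ?thesis using PD(2)[of 1] Hurst[of 1] m_pos \<open>k < N\<close> unfolding Q_def by auto
qed

lemma Gamma_mat_carrier: "Gamma_mat h m H N \<in> carrier_mat N N"
  by (simp add: Gamma_mat_def)

lemma time_vec_carrier: "time_vec h N \<in> carrier_vec N"
  by (simp add: time_vec_def)

lemma Gamma_mat_mult_vec:
  assumes "x \<in> carrier_vec N" "i < N"
  shows "(Gamma_mat h m H N *\<^sub>v x) $ i = (\<Sum>j<N. cov (grid h (Suc i)) (grid h (Suc j)) * x $ j)"
  using assms by (simp add: Gamma_mat_def cov_def scalar_prod_def atLeast0LessThan)

lemma transpose_Gamma_mat: "transpose_mat (Gamma_mat h m H N) = Gamma_mat h m H N"
  by (rule eq_matI) (simp_all add: Gamma_mat_def fbm_cov_commute)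

text \<open>Definiteness rules out \<open>None\<close>, so the \<open>the\<close> in
  \<open>Gamma_inv\<close> yields a genuine inverse.\<close>

lemma Gamma_inv_inverse:
  shows "Gamma_inv h m H N \<in> carrier_mat N N"
    and "Gamma_mat h m H N * Gamma_inv h m H N = 1\<^sub>m N"
proof -
  have definite: "x = 0\<^sub>v N" if x: "x \<in> carrier_vec N" and zero: "x \<bullet> (Gamma_mat h m H N *\<^sub>v x) = 0" for x
  proof -
    have "x \<bullet> (Gamma_mat h m H N *\<^sub>v x) = (\<Sum>i<N. x $ i * (Gamma_mat h m H N *\<^sub>v x) $ i)"
      using Gamma_mat_carrier[of N] by (simp add: scalar_prod_def atLeast0LessThan)
    also have "\<dots> = (\<Sum>i<N. \<Sum>j<N. x $ i * x $ j * cov (grid h (Suc i)) (grid h (Suc j)))"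
      using x by (intro sum.cong refl) (simp add: Gamma_mat_mult_vec sum_distrib_left mult_ac)
    finally have "(\<Sum>i<N. \<Sum>j<N. x $ i * x $ j * cov (grid h (Suc i)) (grid h (Suc j))) = 0"
      using zero by simp
    then have "x $ k = 0" if "k < N" for k using cov_definite that by blast
    then show ?thesis using x by (intro eq_vecI) auto
  qed
  obtain A where "mat_inverse (Gamma_mat h m H N) = Some A" "A \<in> carrier_mat N N" "Gamma_mat h m H N * A = 1\<^sub>m N"
    using mat_inverse_positive_definite[OF Gamma_mat_carrier definite] by blast
  then show "Gamma_inv h m H N \<in> carrier_mat N N" "Gamma_mat h m H N * Gamma_inv h m H N = 1\<^sub>m N"
    by (simp_all add: Gamma_inv_def)
qed

section \<open>Weights of the generalised least squares estimator\<close>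

definition gls_weight :: "nat \<Rightarrow> nat \<Rightarrow> real" where
  "gls_weight N i = (Gamma_inv h m H N *\<^sub>v time_vec h N) $ i"

lemma Gamma_mat_inv_mult_vec:
  assumes "x \<in> carrier_vec N"
  shows "Gamma_mat h m H N *\<^sub>v (Gamma_inv h m H N *\<^sub>v x) = x"
  using assms Gamma_inv_inverse[of N] Gamma_mat_carrier[of N]
  by (simp flip: assoc_mult_mat_vec)

text \<open>Row \<open>i\<close> of the equation \<open>\<Gamma> w = T\<close>. Its right side does
  not depend on \<open>N\<close>, so on a longer grid the rows of a shorter one keep their
  values.\<close>

lemma cov_gls_weight:
  assumes "i < N"
  shows "(\<Sum>j<N. cov (grid h (Suc i)) (grid h (Suc j)) * gls_weight N j) = grid h (Suc i)"
  using assms Gamma_mat_mult_vec[of "Gamma_inv h m H N *\<^sub>v time_vec h N" N i]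
    Gamma_inv_inverse(1)[of N] time_vec_carrier[of N]
  by (simp add: Gamma_mat_inv_mult_vec gls_weight_def) (simp add: time_vec_def)

text \<open>With \<open>T = \<Gamma> u\<close>, symmetry moves \<open>\<Gamma>\<close> to the other
  factor, where it cancels the inverse applied to \<open>y\<close>.\<close>

lemma time_vec_Gamma_inv:
  assumes y: "y \<in> carrier_vec N"
  shows "time_vec h N \<bullet> (Gamma_inv h m H N *\<^sub>v y) = (\<Sum>i<N. gls_weight N i * y $ i)"
proof -
  let ?u = "Gamma_inv h m H N *\<^sub>v time_vec h N"
  have u: "?u \<in> carrier_vec N" and z: "Gamma_inv h m H N *\<^sub>v y \<in> carrier_vec N"
    by (rule mult_mat_vec_carrier[OF Gamma_inv_inverse(1)], rule time_vec_carrier y)+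
  have "time_vec h N \<bullet> (Gamma_inv h m H N *\<^sub>v y) = (transpose_mat (Gamma_mat h m H N) *\<^sub>v ?u) \<bullet> (Gamma_inv h m H N *\<^sub>v y)"
    by (simp add: transpose_Gamma_mat Gamma_mat_inv_mult_vec time_vec_carrier)
  also have "\<dots> = ?u \<bullet> y"
    by (simp add: transpose_vec_mult_scalar[OF Gamma_mat_carrier z u] Gamma_mat_inv_mult_vec y)
  finally show ?thesis
    using y by (simp add: scalar_prod_def gls_weight_def atLeast0LessThan)
qed

lemma d_coeff_eq: "d_coeff h m H N = (\<Sum>i<N. gls_weight N i * grid h (Suc i))"
  unfolding d_coeff_def by (subst time_vec_Gamma_inv[OF time_vec_carrier]) (simp add: time_vec_def)

lemma d_coeff_nonzero:
  assumes "N \<ge> 1"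
  shows "d_coeff h m H N \<noteq> 0"
proof
  assume "d_coeff h m H N = 0"
  moreover have "d_coeff h m H N =
      (\<Sum>i<N. gls_weight N i * (\<Sum>j<N. cov (grid h (Suc i)) (grid h (Suc j)) * gls_weight N j))"
    unfolding d_coeff_eq by (intro sum.cong refl) (simp add: cov_gls_weight)
  ultimately have "(\<Sum>i<N. \<Sum>j<N. gls_weight N i * gls_weight N j * cov (grid h (Suc i)) (grid h (Suc j))) = 0"
    by (simp add: sum_distrib_left mult_ac)
  then have "gls_weight N k = 0" if "k < N" for k
    using that by (rule cov_definite)
  \<comment> \<open>The weights would all be 0, contradicting row 0, whose right side is
    \<open>h > 0\<close>; this row exists because \<open>N \<ge> 1\<close>.\<close>
  then show False
    using cov_gls_weight[of 0 N] grid_pos[of 0] assms by simp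
qed

text \<open>The drift contributes \<open>\<theta>\<close> times \<open>d_coeff\<close>, so after
  division exactly \<open>\<theta>\<close> is removed and a linear combination of noise values
  remains.\<close>

lemma theta_hat_error:
  assumes "N \<ge> 1"
  shows "theta_hat h m H (mixed_process m \<theta> \<alpha> B) N \<omega> - \<theta> =
    (\<Sum>i<N. \<alpha> * gls_weight N i / d_coeff h m H N * noise (grid h (Suc i)) \<omega>)"
proof -
  have "time_vec h N \<bullet> (Gamma_inv h m H N *\<^sub>v obs_vec h N (mixed_process m \<theta> \<alpha> B) \<omega>) =
      (\<Sum>i<N. gls_weight N i * (\<theta> * grid h (Suc i) + \<alpha> * noise (grid h (Suc i)) \<omega>))"
    by (subst time_vec_Gamma_inv) (simp_all add: obs_vec_def mixed_process_def noise_def)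
  also have "\<dots> = \<theta> * d_coeff h m H N + (\<Sum>i<N. \<alpha> * gls_weight N i * noise (grid h (Suc i)) \<omega>)"
    unfolding d_coeff_eq by (simp add: sum_distrib_left distrib_left sum.distrib mult_ac)
  finally show ?thesis
    using d_coeff_nonzero[OF assms] by (simp add: theta_hat_def add_divide_distrib sum_divide_distrib)
qed

section \<open>Joint law of the estimation errors\<close>

context
  fixes \<theta> \<alpha> :: real and \<xi> :: "nat \<Rightarrow> 'a \<Rightarrow> real"
  defines "\<xi> \<equiv> \<lambda>N \<omega>. theta_hat h m H (mixed_process m \<theta> \<alpha> B) N \<omega> - \<theta>"
begin

lemma jointly_gaussian_error: "jointly_gaussian M {1..} \<xi>"
  unfolding jointly_gaussian_def
proof (intro allI impI)
  fix J :: "nat set" and c assume J: "finite J \<and> J \<subseteq> {1..}"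
  have "(\<Sum>N\<in>J. c N * \<xi> N \<omega>) = (\<Sum>N\<in>J. \<Sum>i<N. c N * (\<alpha> * gls_weight N i / d_coeff h m H N) * noise (grid h (Suc i)) \<omega>)" for \<omega>
    using J by (intro sum.cong refl) (auto simp: \<xi>_def theta_hat_error sum_distrib_left mult.assoc)
  \<comment> \<open>The double sum is flattened to pairs \<open>(N, i)\<close>; one grid time occurs
    for several \<open>N\<close>.\<close>
  also have "\<dots> \<omega> = (\<Sum>s\<in>(SIGMA N:J. {..<N}). c (fst s) * (\<alpha> * gls_weight (fst s) (snd s) / d_coeff h m H (fst s)) *
      noise (grid h (Suc (snd s))) \<omega>)" for \<omega>
    using J by (subst sum.Sigma) (auto simp: case_prod_beta)
  finally have eq: "(\<lambda>\<omega>. \<Sum>N\<in>J. c N * \<xi> N \<omega>) = (\<lambda>\<omega>. \<Sum>s\<in>(SIGMA N:J. {..<N}).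
      c (fst s) * (\<alpha> * gls_weight (fst s) (snd s) / d_coeff h m H (fst s)) * noise (grid h (Suc (snd s))) \<omega>)"
    by (rule ext)
  show "gaussian_rv M (\<lambda>\<omega>. \<Sum>N\<in>J. c N * \<xi> N \<omega>)"
    unfolding eq using J less_imp_le[OF grid_pos]
    by (intro jointly_gaussian_linear_combination[OF jointly_gaussian_noise]) (auto intro: finite_SigmaI)
qed

lemma expectation_error:
  assumes "N \<ge> 1" shows "expectation (\<xi> N) = 0"
  using assms less_imp_le[OF grid_pos]
  by (simp add: \<xi>_def theta_hat_error gaussian_noise gaussian_rv_integrable expectation_noise)

lemma expectation_error_mult_le:
  assumes "1 \<le> N" "N \<le> N'"
  shows "expectation (\<lambda>\<omega>. \<xi> N \<omega> * \<xi> N' \<omega>) = v_coeff h m H \<alpha> N'"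
proof -
  define a where "a n i = \<alpha> * gls_weight n i / d_coeff h m H n" for n i
  let ?t = "\<lambda>i. grid h (Suc i)"
  have "expectation (\<lambda>\<omega>. \<xi> N \<omega> * \<xi> N' \<omega>) =
      expectation (\<lambda>\<omega>. \<Sum>i<N. \<Sum>j<N'. a N i * a N' j * (noise (?t i) \<omega> * noise (?t j) \<omega>))"
    using assms by (simp add: \<xi>_def theta_hat_error a_def[symmetric] sum_product mult_ac)
  also have "\<dots> = (\<Sum>i<N. \<Sum>j<N'. a N i * a N' j * cov (?t i) (?t j))"
    using less_imp_le[OF grid_pos] by (simp add: gaussian_rv_mult_integrable gaussian_noise expectation_noise_mult)
  also have "\<dots> = (\<Sum>i<N. a N i * (\<alpha> / d_coeff h m H N') * (\<Sum>j<N'. cov (?t i) (?t j) * gls_weight N' j))"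
    by (simp add: a_def sum_distrib_left sum_divide_distrib mult_ac)
  \<comment> \<open>The inner sum runs over the longer grid, and \<open>i < N \<le> N'\<close> makes
    it one of the rows solved by the weights for \<open>N'\<close>.\<close>
  also have "\<dots> = (\<Sum>i<N. a N i * (\<alpha> / d_coeff h m H N') * ?t i)"
    using assms by (intro sum.cong refl) (simp add: cov_gls_weight)
  also have "\<dots> = \<alpha>\<^sup>2 / (d_coeff h m H N * d_coeff h m H N') * (\<Sum>i<N. gls_weight N i * ?t i)"
    by (simp add: a_def sum_distrib_left sum_divide_distrib power2_eq_square mult_ac)
  \<comment> \<open>The remaining sum is \<open>d_coeff\<close> at \<open>N\<close> and cancels that
    factor, leaving only \<open>N'\<close>.\<close>
  also have "\<dots> = v_coeff h m H \<alpha> N'"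
    using d_coeff_nonzero[OF assms(1)] unfolding d_coeff_eq[symmetric] v_coeff_def by simp
  finally show ?thesis .
qed

lemma expectation_error_mult:
  assumes "1 \<le> N" "1 \<le> N'"
  shows "expectation (\<lambda>\<omega>. \<xi> N \<omega> * \<xi> N' \<omega>) = v_coeff h m H \<alpha> (max N N')"
proof (cases "N \<le> N'")
  case True
  then show ?thesis using expectation_error_mult_le[OF assms(1) True] by simp
next
  case False
  then show ?thesis using expectation_error_mult_le[OF assms(2), of N] by (simp add: mult.commute)
qed

end

end

theorem theorem4p8:
  fixes M :: "'a measure"
    and h \<theta> \<alpha> :: real
    and m :: nat
    and H :: "nat \<Rightarrow> real"
    and B :: "nat \<Rightarrow> real \<Rightarrow> 'a \<Rightarrow> real"
    and Z :: "real \<Rightarrow> 'a \<Rightarrow> real"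
    and est \<xi> :: "nat \<Rightarrow> 'a \<Rightarrow> real"
    and v :: "nat \<Rightarrow> real"
  assumes "prob_space M"
    and "h > 0"
    and "m \<ge> 1"
    and "\<And>r. r \<in> {1..m} \<Longrightarrow> 1/2 < H r \<and> H r < 1"
    and "\<And>r. r \<in> {1..m} \<Longrightarrow> fractional_brownian_motion M (H r) (B r)"
    and "independent_processes M {1..m} B"
    and "\<alpha> > 0"
  defines "Z \<equiv> mixed_process m \<theta> \<alpha> B"
    and "est \<equiv> theta_hat h m H Z"
    and "\<xi> \<equiv> \<lambda>N \<omega>. est N \<omega> - \<theta>"
    and "v \<equiv> v_coeff h m H \<alpha>"
  shows "jointly_gaussian M {1..} \<xi>
    \<and> (\<forall>N\<ge>1. (LINT \<omega>|M. \<xi> N \<omega>) = 0)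
    \<and> (\<forall>N\<ge>1. covariance M (est N) (est N) = v N)
    \<and> (\<forall>N\<ge>1. \<forall>N'\<ge>1. (LINT \<omega>|M. \<xi> N \<omega> * \<xi> N' \<omega>) = v (max N N'))
    \<and> independent_increments M {1..} est
    \<and> (\<forall>N1 N2 N3 N4. 1 \<le> N1 \<and> N1 \<le> N2 \<and> N2 \<le> N3 \<and> N3 \<le> N4 \<longrightarrow>
         covariance M (\<lambda>\<omega>. est N4 \<omega> - est N3 \<omega>) (\<lambda>\<omega>. est N2 \<omega> - est N1 \<omega>) = 0 \<and>
         prob_space.indep_var M
           borel (\<lambda>\<omega>. est N4 \<omega> - est N3 \<omega>)
           borel (\<lambda>\<omega>. est N2 \<omega> - est N1 \<omega>))"
proof -
  interpret mixed_fbm M h m H B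
  proof (intro mixed_fbm.intro mixed_fbm_axioms.intro)
    show "0 < H r \<and> H r < 1" if "r \<in> {1..m}" for r
      using assms(4)[OF that] by simp
  qed (fact assms)+
  have \<xi>_eq: "\<xi> = (\<lambda>N \<omega>. theta_hat h m H (mixed_process m \<theta> \<alpha> B) N \<omega> - \<theta>)"
    by (simp add: \<xi>_def est_def Z_def)
  note gaussian = jointly_gaussian_error[of \<theta> \<alpha>, folded \<xi>_eq]
  have mean: "expectation (\<xi> N) = 0" if "N \<in> {1..}" for N
    using expectation_error[of N \<theta> \<alpha>] that by (simp add: \<xi>_eq)
  have cov: "expectation (\<lambda>\<omega>. \<xi> N \<omega> * \<xi> N' \<omega>) = v (max N N')" if "N \<in> {1..}" "N' \<in> {1..}" for N N'
    using expectation_error_mult[of N N' \<theta> \<alpha>, folded v_def] that by (simp add: \<xi>_eq)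
  \<comment> \<open>Increments of the estimator and of its error coincide, so the results for
    centred sequences carry over.\<close>
  have est_diff: "est N \<omega> - est N' \<omega> = \<xi> N \<omega> - \<xi> N' \<omega>" for N N' \<omega>
    by (simp add: \<xi>_def)
  have mean_est: "expectation (est N) = \<theta>" if "N \<ge> 1" for N
  proof -
    have "integrable M (\<xi> N)"
      using jointly_gaussianD[OF gaussian] that by (simp add: gaussian_rv_integrable)
    then have "expectation (\<lambda>\<omega>. \<xi> N \<omega> + \<theta>) = \<theta>"
      using mean[of N] that by (simp add: prob_space)
    then show ?thesis by (simp add: \<xi>_def)
  qed
  show ?thesis
  proof (intro conjI allI impI)
    show "jointly_gaussian M {1..} \<xi>" by (rule gaussian)
    show "expectation (\<xi> N) = 0" if "N \<ge> 1" for N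
      using mean that by simp
    \<comment> \<open>Since the estimator has mean \<open>\<theta>\<close>, its variance is the
      second moment of \<open>\<xi> N\<close>, the case \<open>N = N'\<close> of the covariance
      formula.\<close>
    show "covariance M (est N) (est N) = v N" if "N \<ge> 1" for N
      using cov[of N N] that unfolding covariance_def mean_est[OF that] by (simp add: \<xi>_def)
    show "expectation (\<lambda>\<omega>. \<xi> N \<omega> * \<xi> N' \<omega>) = v (max N N')" if "N \<ge> 1" "N' \<ge> 1" for N N'
      using cov that by simp
    show "independent_increments M {1..} est"
      using gaussian_independent_increments[OF gaussian mean cov]
      unfolding independent_increments_def est_diff .
    fix N1 N2 N3 N4 :: nat
    assume N: "1 \<le> N1 \<and> N1 \<le> N2 \<and> N2 \<le> N3 \<and> N3 \<le> N4"
    show "covariance M (\<lambda>\<omega>. est N4 \<omega> - est N3 \<omega>) (\<lambda>\<omega>. est N2 \<omega> - est N1 \<omega>) = 0"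
      unfolding est_diff by (rule uncorrelated_increments[OF gaussian mean cov]) (use N in auto)
    show "indep_var borel (\<lambda>\<omega>. est N4 \<omega> - est N3 \<omega>) borel (\<lambda>\<omega>. est N2 \<omega> - est N1 \<omega>)"
      unfolding est_diff by (rule gaussian_independent_two_increments[OF gaussian mean cov]) (use N in auto)
  qed
qed

end
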